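(* Let $\boldsymbol{\mu}$ be a projection on $K$ types which is entire, finite, nondegenerate, nonlocalized and irreducible. Then the set $\mathcal{D}_{asy}\subset\mathbb{R}^K$ is nonempty, open and convex. Furthermore, for any $\ell\ge 1$, any $\Gamma\in\mathcal{M}^*_{\ell,K}(\mathbb{Z})$ and any $\overline{\theta}\in\mathbb{R}^K$, either $\mathcal{D}_{asy}^{\Gamma,\overline{\theta}}=\{\mathbf{0}\}$ or $\mathbf{0}\notin\mathcal{D}_{asy}^{\Gamma,\overline{\theta}}$. (1) In the first case, $\overline{\theta}$ is critical (that is, $\overline\theta\in\mathcal{M}_{crit}$), $\Gamma X_{\overline{\theta}}=\mathbf{0}$ and $\{\theta\in\mathbb{R}^K : \theta\sim_\Gamma\overline{\theta}\}=\{\overline{\theta}\}$. (2) In the second case, for any $X\in\mathcal{D}_{asy}$ such that $\Gamma X\neq\mathbf{0}$, there exists a unique couple $(\theta,\lambda)\in\mathcal{M}_{crit}\times(0,+\infty)$ such that $\theta\sim_\Gamma\overline{\theta}$ and $\Gamma X_\theta=\lambda\,\Gamma X$. Moreover this $\theta$ is the unique maximizer of $f_X:\theta\mapsto -X^{\intercal}\chi(\theta)$ on $\{\theta\in\mathbb{R}^K : \theta\sim_\Gamma\overline{\theta}\}$.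
   Context: Fix an integer $K\ge1$; $[K]=\{1,\dots,K\}$, $\mathbb{Z}_+=\{0,1,\dots\}$. $\mathcal{M}^*_{\ell,K}(\mathbb{Z})$ is the set of nonzero $\ell\times K$ integer matrices. A projection is a family $\boldsymbol{\mu}=(\mu^{(1)},\dots,\mu^{(K)})$ of probability distributions on $\mathbb{Z}_+^K$, with generating functions $\phi^{(i)}(x_1,\dots,x_K)=\sum_{k\in\mathbb{Z}_+^K}\mu^{(i)}(k)x_1^{k_1}\cdots x_K^{k_K}$ and mean matrix $M=(m_{i,j})$, $m_{i,j}=\sum_{z\in\mathbb{Z}_+^K}z_j\mu^{(i)}(z)$. $\mathcal{T}^{(i)}$ denotes the multitype Bienaymé-Galton-Watson tree with root of type $i$ in which each vertex of type $j$ has, independently, children whose numbers of each type are distributed as $\mu^{(j)}$. $\boldsymbol{\mu}$ is: entire if every $\phi^{(i)}$ is entire; finite if $\mathbb{P}(|\mathcal{T}^{(i)}|<\infty)>0$ for all $i\in[K]$; nondegenerate if $\mu^{(i)}(\{z:\sum_j z_j\ge2\})>0$ for some $i$; nonlocalized if for all $X\in\mathbb{R}^K\setminus\{\mathbf{0}\}$ there is $i\in[K]$ such that, for $(k_1,\dots,k_K)$ distributed as $\mu^{(i)}$, $\sum_jX_jk_j$ is not deterministic; irreducible if for all $i,j$ there is $p\ge1$ with $(M^p)_{i,j}>0$; critical if the spectral radius of $M$ is $1$. For $\theta\in\mathbb{R}^K$ the exponential tilting $\boldsymbol{\mu}_\theta=(\mu_\theta^{(i)})_{i\in[K]}$ is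 $\mu^{(i)}_\theta(k)=\mu^{(i)}(k)e^{\theta\cdot k}/\phi^{(i)}(e^\theta)$, where $e^\theta=(e^{\theta_1},\dots,e^{\theta_K})$. $M_\theta$ is its mean matrix, $\rho_\theta$ the spectral radius of $M_\theta$, and $\mathcal{M}_{crit}=\{\theta\in\mathbb{R}^K:\rho_\theta=1\}$. For $\theta\in\mathcal{M}_{crit}$, the asymptotic direction $X_\theta\in(0,\infty)^K$ is the unique vector with positive coordinates with $X_\theta^{\intercal}M_\theta=X_\theta^{\intercal}$ and $\|X_\theta\|_1=1$ (Perron-Frobenius). $\chi=(\chi_1,\dots,\chi_K)^{\intercal}:\mathbb{R}^K\to\mathbb{R}^K$ is $\chi_i(\theta)=\log\phi^{(i)}(e^\theta)-\theta_i$. For an integer matrix $\Gamma$ with $K$ columns, $\theta\sim_\Gamma\theta'$ means $\chi(\theta)-\chi(\theta')\in(\ker\Gamma)^\perp$. The asymptotic cones are $$\mathcal{D}_{asy}=\{\lambda X_\theta:\lambda\in(0,\infty),\theta\in\mathcal{M}_{crit}\},\qquad \mathcal{D}_{asy}^{\Gamma,\overline\theta}=\{\lambda\Gamma X_\theta:\lambda\in(0,\infty),\theta\in\mathcal{M}_{crit},\theta\sim_\Gamma\overline\theta\}.$$ *)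

theory Defs
  imports "HOL-Probability.Probability"
begin

text \<open>
  The types are the elements of a finite type \<open>'k\<close> (so \<open>K = CARD('k) \<ge> 1\<close>), and elements of
  $\mathbb{Z}_+^K$ are vectors of type \<open>nat ^ 'k\<close>.
\<close>

type_synonym 'k projection = "'k \<Rightarrow> (nat ^ 'k) pmf"


section \<open>Projections and their properties\<close>

definition monomial :: "'a::comm_semiring_1 ^ 'k \<Rightarrow> nat ^ 'k \<Rightarrow> 'a" where
  "monomial x k = (\<Prod>j\<in>UNIV. (x $ j) ^ (k $ j))"

definition gen_fun :: "'k projection \<Rightarrow> 'k \<Rightarrow> real ^ 'k \<Rightarrow> real" where
  "gen_fun \<mu> i x = (\<Sum>\<^sub>\<infinity>k. pmf (\<mu> i) k * monomial x k)"

text \<open>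
  Entire: the power series of every generating function converges (unconditionally, hence
  absolutely) at every point of $\mathbb{C}^K$. Under this hypothesis the infinite sums in
  \<open>gen_fun\<close> and \<open>mean_matrix\<close> have no junk values.
\<close>

definition entire_proj :: "'k::finite projection \<Rightarrow> bool" where
  "entire_proj \<mu> \<longleftrightarrow>
     (\<forall>i. \<forall>x :: complex ^ 'k. (\<lambda>k. complex_of_real (pmf (\<mu> i) k) * monomial x k) summable_on UNIV)"

definition mean_matrix :: "'k::finite projection \<Rightarrow> real ^ 'k ^ 'k" where
  "mean_matrix \<mu> = (\<chi> i j. \<Sum>\<^sub>\<infinity>z. real (z $ j) * pmf (\<mu> i) z)"

text \<open>
  The multitype Bienayme-Galton-Watson tree, with Ulam-Harris labels. A label is the list of the
  steps leading from the root to a vertex, \<^emph>\<open>latest step first\<close>; the step \<open>(j, n)\<close> goes to the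
  \<open>n\<close>-th child (counted from \<open>0\<close>) among the children of type \<open>j\<close>. A vertex thus has the type recorded
  in the head of its label, and the root \<open>[]\<close> has the prescribed type \<open>i\<close>. A sample point \<open>\<omega>\<close> assigns
  an offspring vector to every label, independently and with the law prescribed by its type.
\<close>

type_synonym 'k label = "('k \<times> nat) list"

primrec label_type :: "'k \<Rightarrow> 'k label \<Rightarrow> 'k" where
  "label_type i [] = i"
| "label_type i (s # u) = fst s"

definition offspring_space :: "'k::finite projection \<Rightarrow> 'k \<Rightarrow> ('k label \<Rightarrow> nat ^ 'k) measure" where
  "offspring_space \<mu> i = (\<Pi>\<^sub>M u\<in>UNIV. measure_pmf (\<mu> (label_type i u)))"

inductive_set bgw_tree :: "('k label \<Rightarrow> nat ^ 'k) \<Rightarrow> 'k label set" for \<omega> where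
  root: "[] \<in> bgw_tree \<omega>"
| child: "u \<in> bgw_tree \<omega> \<Longrightarrow> n < \<omega> u $ j \<Longrightarrow> (j, n) # u \<in> bgw_tree \<omega>"

definition finite_proj :: "'k::finite projection \<Rightarrow> bool" where
  "finite_proj \<mu> \<longleftrightarrow> (\<forall>i. \<P>(\<omega> in offspring_space \<mu> i. finite (bgw_tree \<omega>)) > 0)"

definition nondegenerate_proj :: "'k::finite projection \<Rightarrow> bool" where
  "nondegenerate_proj \<mu> \<longleftrightarrow> (\<exists>i. measure_pmf.prob (\<mu> i) {z. (\<Sum>j\<in>UNIV. z $ j) \<ge> 2} > 0)"

definition nonlocalized_proj :: "'k::finite projection \<Rightarrow> bool" where
  "nonlocalized_proj \<mu> \<longleftrightarrow>
     (\<forall>X :: real ^ 'k. X \<noteq> 0 \<longrightarrow>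
        (\<exists>i. \<not> (\<exists>c. AE k in measure_pmf (\<mu> i). (\<Sum>j\<in>UNIV. X $ j * real (k $ j)) = c)))"

text \<open>The power operator of the library acts on \<open>real ^ 'k ^ 'k\<close> componentwise, hence:\<close>

definition matrix_power :: "real ^ 'k ^ 'k \<Rightarrow> nat \<Rightarrow> real ^ 'k ^ 'k" where
  "matrix_power A p = ((\<lambda>B. A ** B) ^^ p) (mat 1)"

definition irreducible_proj :: "'k::finite projection \<Rightarrow> bool" where
  "irreducible_proj \<mu> \<longleftrightarrow> (\<forall>i j. \<exists>p\<ge>1. matrix_power (mean_matrix \<mu>) p $ i $ j > 0)"

definition complex_spectrum :: "real ^ 'k ^ 'k \<Rightarrow> complex set" where
  "complex_spectrum A = {z. \<exists>v. v \<noteq> 0 \<and> map_matrix complex_of_real A *v v = z *s v}"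

definition spectral_radius :: "real ^ 'k ^ 'k \<Rightarrow> real" where
  "spectral_radius A = Max (cmod ` complex_spectrum A)"


section \<open>Exponential tilting and the critical set\<close>

definition exp_vec :: "real ^ 'k \<Rightarrow> real ^ 'k" where
  "exp_vec \<theta> = (\<chi> j. exp (\<theta> $ j))"

text \<open>
  \<open>embed_pmf\<close> turns a function that is nonnegative with total mass one into the corresponding
  distribution; this is the case here for entire \<open>\<mu>\<close>, see \<open>pmf_tilt\<close> below.
\<close>

definition tilt :: "'k::finite projection \<Rightarrow> real ^ 'k \<Rightarrow> 'k projection" where
  "tilt \<mu> \<theta> i =
     embed_pmf (\<lambda>k. pmf (\<mu> i) k * exp (\<Sum>j\<in>UNIV. \<theta> $ j * real (k $ j)) / gen_fun \<mu> i (exp_vec \<theta>))"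

definition M_crit :: "'k::finite projection \<Rightarrow> (real ^ 'k) set" where
  "M_crit \<mu> = {\<theta>. spectral_radius (mean_matrix (tilt \<mu> \<theta>)) = 1}"

definition asy_dir :: "'k::finite projection \<Rightarrow> real ^ 'k \<Rightarrow> real ^ 'k" where
  "asy_dir \<mu> \<theta> =
     (THE X. (\<forall>j. X $ j > 0) \<and> X v* mean_matrix (tilt \<mu> \<theta>) = X \<and> (\<Sum>j\<in>UNIV. \<bar>X $ j\<bar>) = 1)"


section \<open>Equivalence of parameters and asymptotic cones\<close>

definition chi_map :: "'k::finite projection \<Rightarrow> real ^ 'k \<Rightarrow> real ^ 'k" where
  "chi_map \<mu> \<theta> = (\<chi> i. ln (gen_fun \<mu> i (exp_vec \<theta>)) - \<theta> $ i)"

abbreviation real_matrix :: "int ^ 'k ^ 'l \<Rightarrow> real ^ 'k ^ 'l" where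
  "real_matrix \<equiv> map_matrix real_of_int"

definition proj_equiv ::
    "'k::finite projection \<Rightarrow> int ^ 'k ^ 'l \<Rightarrow> real ^ 'k \<Rightarrow> real ^ 'k \<Rightarrow> bool" where
  "proj_equiv \<mu> \<Gamma> \<theta> \<theta>' \<longleftrightarrow>
     chi_map \<mu> \<theta> - chi_map \<mu> \<theta>' \<in> orthogonal_comp {v. real_matrix \<Gamma> *v v = 0}"

definition D_asy :: "'k::finite projection \<Rightarrow> (real ^ 'k) set" where
  "D_asy \<mu> = {c *\<^sub>R asy_dir \<mu> \<theta> | c \<theta>. c > 0 \<and> \<theta> \<in> M_crit \<mu>}"

definition D_asy_proj ::
    "'k::finite projection \<Rightarrow> int ^ 'k ^ 'l \<Rightarrow> real ^ 'k \<Rightarrow> (real ^ 'l) set" where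
  "D_asy_proj \<mu> \<Gamma> \<theta>\<^sub>0 =
     {c *\<^sub>R (real_matrix \<Gamma> *v asy_dir \<mu> \<theta>) | c \<theta>. c > 0 \<and> \<theta> \<in> M_crit \<mu> \<and> proj_equiv \<mu> \<Gamma> \<theta> \<theta>\<^sub>0}"


section \<open>Well-definedness of the tilting and of the event of finiteness\<close>

lemma monomial_exp_vec:
  "monomial (exp_vec \<theta>) k = exp (\<Sum>j\<in>UNIV. \<theta> $ j * real (k $ j))"
  by (simp add: monomial_def exp_vec_def exp_sum exp_of_nat2_mult)

lemma summable_gen_fun:
  assumes "entire_proj \<mu>"
  shows "(\<lambda>k. pmf (\<mu> i) k * monomial x k) summable_on UNIV"
proof -
  have *: "complex_of_real (pmf (\<mu> i) k * monomial x k) =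
      complex_of_real (pmf (\<mu> i) k) * monomial (\<chi> j. complex_of_real (x $ j)) k" for k
    by (simp add: monomial_def)
  have "(\<lambda>k. complex_of_real (pmf (\<mu> i) k * monomial x k)) summable_on UNIV"
    unfolding * using assms by (simp add: entire_proj_def)
  from summable_on_Re[OF this] show ?thesis by simp
qed

lemma gen_fun_exp_pos:
  assumes "entire_proj \<mu>"
  shows "gen_fun \<mu> i (exp_vec \<theta>) > 0"
proof -
  obtain k where k: "k \<in> set_pmf (\<mu> i)" using set_pmf_not_empty by fast
  have "0 < pmf (\<mu> i) k * monomial (exp_vec \<theta>) k"
    using k by (simp add: monomial_exp_vec pmf_positive)
  also have "\<dots> = (\<Sum>\<^sub>\<infinity>k\<in>{k}. pmf (\<mu> i) k * monomial (exp_vec \<theta>) k)" by simp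
  also have "\<dots> \<le> gen_fun \<mu> i (exp_vec \<theta>)"
    unfolding gen_fun_def
    by (rule infsum_mono_neutral)
       (use summable_gen_fun[OF assms] in auto, simp add: monomial_exp_vec)
  finally show ?thesis .
qed

lemma pmf_tilt:
  assumes "entire_proj \<mu>"
  shows "pmf (tilt \<mu> \<theta> i) k =
    pmf (\<mu> i) k * exp (\<Sum>j\<in>UNIV. \<theta> $ j * real (k $ j)) / gen_fun \<mu> i (exp_vec \<theta>)"
proof -
  let ?Z = "gen_fun \<mu> i (exp_vec \<theta>)"
  let ?f = "\<lambda>k. pmf (\<mu> i) k * monomial (exp_vec \<theta>) k"
  note pos = gen_fun_exp_pos[OF assms, of i \<theta>]
  have nn: "?f k \<ge> 0" for k by (simp add: monomial_exp_vec)
  have s: "Infinite_Set_Sum.abs_summable_on ?f UNIV"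
    unfolding abs_summable_equivalent[symmetric] real_norm_def abs_of_nonneg[OF nn]
    by (rule summable_gen_fun[OF assms])
  then have int: "integrable (count_space UNIV) ?f"
    by (simp add: Infinite_Set_Sum.abs_summable_on_def)
  have "(\<integral>x. ?f x \<partial>count_space UNIV) = ?Z"
    unfolding gen_fun_def infsetsum_infsum[OF s, symmetric] infsetsum_def ..
  then have "(\<integral>\<^sup>+x. ennreal (?f x) \<partial>count_space UNIV) = ennreal ?Z"
    using nn_integral_eq_integral[OF int] nn by simp
  then have "(\<integral>\<^sup>+x. ennreal (?f x) / ennreal ?Z \<partial>count_space UNIV) = 1"
    using pos by (simp add: nn_integral_divide ennreal_divide_self)
  then have "(\<integral>\<^sup>+x. ennreal (?f x / ?Z) \<partial>count_space UNIV) = 1"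
    unfolding divide_ennreal[OF nn pos] .
  then show ?thesis
    unfolding tilt_def using pos by (subst pmf_embed_pmf) (auto simp: monomial_exp_vec)
qed

lemma bgw_tree_Cons:
  "s # u \<in> bgw_tree \<omega> \<longleftrightarrow> u \<in> bgw_tree \<omega> \<and> snd s < \<omega> u $ fst s"
  by (cases s) (auto intro: bgw_tree.intros elim: bgw_tree.cases)

lemma sets_finite_bgw_tree:
  "{\<omega> \<in> space (offspring_space \<mu> i). finite (bgw_tree \<omega>)} \<in> sets (offspring_space \<mu> i)"
proof -
  let ?S = "offspring_space \<mu> i"
  have vertex: "Measurable.pred ?S (\<lambda>\<omega>. u \<in> bgw_tree \<omega>)" for u
  proof (induction u)
    case Nil
    then show ?case by (simp add: bgw_tree.root)
  next
    case (Cons s u)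
    have "(\<lambda>\<omega>. \<omega> u) \<in> measurable ?S (measure_pmf (\<mu> (label_type i u)))"
      unfolding offspring_space_def by (rule measurable_component_singleton) simp
    then have "(\<lambda>\<omega>. \<omega> u) \<in> measurable ?S (count_space UNIV)" by simp
    then have "Measurable.pred ?S (\<lambda>\<omega>. snd s < \<omega> u $ fst s)"
      by (rule measurable_compose[of _ _ _ "\<lambda>z. snd s < z $ fst s"]) simp
    with Cons show ?case unfolding bgw_tree_Cons by (rule pred_intros_logic)
  qed
  have "finite (bgw_tree \<omega>) \<longleftrightarrow> (\<exists>us. \<forall>u. u \<in> bgw_tree \<omega> \<longrightarrow> u \<in> set us)"
    for \<omega> :: "'a label \<Rightarrow> nat ^ 'a"
    by (metis finite_list finite_set finite_subset subsetI)
  moreover have "Measurable.pred ?S (\<lambda>\<omega>. \<exists>us. \<forall>u. u \<in> bgw_tree \<omega> \<longrightarrow> u \<in> set us)"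
    by (intro pred_intros_countable pred_intros_logic vertex) simp
  ultimately show ?thesis by (simp add: pred_def)
qed

end

theory Submission
  imports Defs
begin

text \<open>
  Write $M_\theta$ for the mean matrix of the tilted projection. The function \<open>chi_map \<mu>\<close> is
  convex in each coordinate, and row $i$ of $M_\theta - I$ is the gradient of its coordinate $i$
  at $\theta$ (\<open>chi_map_subgradient\<close>). Hence a vector $X$ with positive coordinates satisfies
  $X^T M_\theta = X^T$ exactly when $\theta$ minimizes $X \cdot \chi$. By Perron-Frobenius such a
  $\theta$ is critical and $X$ is a multiple of its asymptotic direction (\<open>M_crit_iff\<close>,
  \<open>asy_dir_eq\<close>), so \<open>D_asy \<mu>\<close> consists of the positive weights $X$ for which $X \cdot \chi$
  attains its minimum (\<open>D_asy_iff\<close>). Nonlocalization makes $X \cdot \chi$ strictly convex, and then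
  attaining the minimum means growing at least linearly at infinity. Linear growth is inherited by
  convex combinations, which gives convexity; the strict inequality between the value at the
  minimizer and the values on a surrounding sphere survives small perturbations of $X$, which gives
  openness.

  For nonemptiness one minimizes the smooth function $\sum_i e^{\chi_i}$: at a minimizer $\theta$ the
  positive weights $e^{\chi_i(\theta)}$ form a left fixed vector of $M_\theta$. A minimizer exists
  because every direction $Y \neq 0$ admits a type $i$ and a possible offspring vector $k$ of $i$ with
  $k \cdot Y > Y_i$ (\<open>no_descent_direction\<close>). This is where finiteness and nondegeneracy of the
  projection are used.

  For the second half let $V = \ker \Gamma$ and $W = V^\perp$. The set of all $\theta$ with
  $\chi(\theta) - \chi(\theta_0) \in W$ need not be convex, but the minimization of $X \cdot \chi$ over it
  has a convex relaxation: minimize $X \cdot w$ over the pairs $(\theta, w)$ with $w \in W$ and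
  $\chi(\theta) - \chi(\theta_0) \le w$ coordinatewise. Its optimum is attained since $X \cdot \chi$
  is coercive, and separation of convex sets yields multipliers $\alpha \ge 0$, $Z \ge 0$ with
  $\alpha X - Z \in V$ (\<open>ex_lagrange_multipliers\<close>). If $\alpha = 0$ then $Z \in V$ and $\theta_0$
  minimizes $Z \cdot \chi$; so $\theta_0$ is critical and $\Gamma$ kills its asymptotic direction,
  which is the degenerate case. If $\alpha > 0$ then the optimal $\theta$ minimizes $Z \cdot \chi$;
  irreducibility forces $Z > 0$, complementary slackness turns every inequality constraint into an
  equality, and so $\theta \sim_\Gamma \theta_0$ with $\Gamma Z = \alpha \Gamma X$. Uniqueness follows
  from strict convexity: if $\Gamma X_\theta = \lambda \Gamma X$, then on the class of $\theta_0$ the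
  functions $X_\theta \cdot \chi$ and $\lambda X \cdot \chi$ differ by a constant.
\<close>

section \<open>Irreducible nonnegative matrices\<close>

text \<open>
  Irreducibility in the form in which the proofs use it: no proper nonempty set of indices is closed
  under the edges \<open>i \<rightarrow> j\<close> with $A_{ij} > 0$. Only the positions of the positive entries matter, and
  exponential tilting does not move them.
\<close>

definition strongly_connected :: "real ^ 'k ^ 'k \<Rightarrow> bool" where
  "strongly_connected A \<longleftrightarrow>
     (\<forall>S. S \<noteq> {} \<longrightarrow> (\<forall>i\<in>S. \<forall>j. A $ i $ j > 0 \<longrightarrow> j \<in> S) \<longrightarrow> S = UNIV)"

lemma strongly_connectedD:
  assumes "strongly_connected A" "i \<in> S" "\<And>i j. i \<in> S \<Longrightarrow> A $ i $ j > 0 \<Longrightarrow> j \<in> S"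
  shows "j \<in> S"
  using assms unfolding strongly_connected_def by blast

lemma matrix_power_pos_imp_reachable:
  fixes A :: "real ^ 'k::finite ^ 'k"
  assumes nn: "\<And>i j. A $ i $ j \<ge> 0"
    and closed: "\<And>i j. i \<in> S \<Longrightarrow> A $ i $ j > 0 \<Longrightarrow> j \<in> S"
  shows "i \<in> S \<Longrightarrow> matrix_power A p $ i $ j > 0 \<Longrightarrow> j \<in> S"
proof (induction p arbitrary: i)
  case 0
  then show ?case by (auto simp: matrix_power_def mat_def split: if_splits)
next
  case (Suc p)
  have "(\<Sum>l\<in>UNIV. A $ i $ l * matrix_power A p $ l $ j) > 0"
    using Suc.prems(2) by (simp add: matrix_power_def matrix_matrix_mult_def)
  then obtain l where "A $ i $ l * matrix_power A p $ l $ j > 0"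
    by (meson not_less sum_nonpos)
  with nn[of i l] have "A $ i $ l > 0" "matrix_power A p $ l $ j > 0"
    by (auto simp: zero_less_mult_iff)
  with Suc closed show ?case by blast
qed

lemma strongly_connectedI_power:
  fixes A :: "real ^ 'k::finite ^ 'k"
  assumes "\<And>i j. A $ i $ j \<ge> 0" "\<And>i j. \<exists>p\<ge>1. matrix_power A p $ i $ j > 0"
  shows "strongly_connected A"
  unfolding strongly_connected_def
proof (intro allI impI)
  fix S assume "S \<noteq> {}" and cl: "\<forall>i\<in>S. \<forall>j. A $ i $ j > 0 \<longrightarrow> j \<in> S"
  then obtain i where i: "i \<in> S" by blast
  have "j \<in> S" for j
    using assms(2)[of i j] matrix_power_pos_imp_reachable[of A S i _ j] assms(1) cl i by blast
  then show "S = UNIV" by auto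
qed

text \<open>
  The support of \<open>Z\<close> is closed under the edges of \<open>A\<close>, because $Z_i A_{ij} \le r Z_j$.
\<close>

lemma left_eigenvector_pos:
  fixes A :: "real ^ 'k::finite ^ 'k"
  assumes nn: "\<And>i j. A $ i $ j \<ge> 0" and sc: "strongly_connected A"
    and Z: "\<And>i. Z $ i \<ge> 0" "Z \<noteq> 0" "Z v* A = r *\<^sub>R Z"
  shows "Z $ j > 0"
proof -
  obtain i where "Z $ i \<noteq> 0" using Z(2) by (auto simp: vec_eq_iff)
  then have i: "i \<in> {i. Z $ i > 0}" using Z(1)[of i] by simp
  have "j \<in> {i. Z $ i > 0}" if "i \<in> {i. Z $ i > 0}" "A $ i $ j > 0" for i j
  proof -
    have "0 < A $ i $ j * Z $ i" using that by simp
    also have "\<dots> \<le> (\<Sum>i\<in>UNIV. A $ i $ j * Z $ i)"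
      by (rule member_le_sum) (use nn Z(1) in auto)
    also have "\<dots> = r * Z $ j"
      using arg_cong[OF Z(3), of "\<lambda>x. x $ j"] by (simp add: vector_matrix_mult_def mult.commute)
    finally show ?thesis using Z(1)[of j] by (auto simp: less_le)
  qed
  from strongly_connectedD[OF sc i this] show ?thesis by simp
qed

text \<open>
  Subtract from \<open>X\<close> the largest multiple of \<open>Y\<close> that leaves a nonnegative vector. The difference is
  again a left eigenvector but has a zero coordinate, so it vanishes by \<open>left_eigenvector_pos\<close>.
\<close>

lemma left_eigenvector_unique:
  fixes A :: "real ^ 'k::finite ^ 'k"
  assumes nn: "\<And>i j. A $ i $ j \<ge> 0" and sc: "strongly_connected A"
    and X: "\<And>i. X $ i > 0" "X v* A = r *\<^sub>R X" and Y: "\<And>i. Y $ i > 0" "Y v* A = r *\<^sub>R Y"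
  obtains t where "X = t *\<^sub>R Y"
proof -
  define t where "t = Min (range (\<lambda>i. X $ i / Y $ i))"
  have "t \<in> range (\<lambda>i. X $ i / Y $ i)" unfolding t_def by (rule Min_in) auto
  then obtain j where j: "t = X $ j / Y $ j" by auto
  have le: "(X - t *\<^sub>R Y) $ i \<ge> 0" for i
  proof -
    have "t \<le> X $ i / Y $ i" unfolding t_def by simp
    then show ?thesis using Y(1)[of i] by (simp add: field_simps)
  qed
  have "(X - t *\<^sub>R Y) $ j = 0" using Y(1)[of j] by (simp add: j)
  moreover have "(X - t *\<^sub>R Y) v* A = r *\<^sub>R (X - t *\<^sub>R Y)"
    using X(2) Y(2)
    by (simp add: vec_eq_iff vector_matrix_mult_def sum_subtractf algebra_simps flip: sum_distrib_left)
  ultimately have "X - t *\<^sub>R Y = 0"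
    using left_eigenvector_pos[OF nn sc le, of r j] by fastforce
  then have "X = t *\<^sub>R Y" by simp
  then show ?thesis by (rule that)
qed

text \<open>
  Perron-Frobenius by Brouwer's theorem, applied to $x \mapsto x(A + I)$ normalized to the standard
  simplex. Adding the identity keeps the normalizing sum at least 1.
\<close>

lemma ex_pos_left_eigenvector:
  fixes A :: "real ^ 'k::finite ^ 'k"
  assumes nn: "\<And>i j. A $ i $ j \<ge> 0" and sc: "strongly_connected A"
  obtains x r where "\<And>i. x $ i > 0" "x v* A = r *\<^sub>R x"
proof -
  define \<Delta> where "\<Delta> = {x :: real ^ 'k. (\<forall>i. x $ i \<ge> 0) \<and> (\<Sum>i\<in>UNIV. x $ i) = 1}"
  define g where "g x = x v* A + x" for x
  define s where "s x = (\<Sum>i\<in>UNIV. g x $ i)" for x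
  have \<Delta>_eq: "\<Delta> = {x. \<forall>i. x $ i \<ge> 0} \<inter> {x. (\<Sum>i\<in>UNIV. x $ i) = 1}" by (auto simp: \<Delta>_def)
  have "closed \<Delta>" unfolding \<Delta>_eq
    by (intro closed_Int closed_Collect_all closed_Collect_le closed_Collect_eq continuous_intros)
  moreover have "\<Delta> \<subseteq> cbox 0 (\<chi> i. 1)"
  proof
    fix x assume x: "x \<in> \<Delta>"
    have "x $ i \<le> 1" for i
      using x member_le_sum[of i UNIV "\<lambda>i. x $ i"] by (simp add: \<Delta>_def)
    with x show "x \<in> cbox 0 (\<chi> i. 1)" by (simp add: mem_box_cart \<Delta>_def)
  qed
  ultimately have compact: "compact \<Delta>" using bounded_subset[OF bounded_cbox] by (simp add: compact_eq_bounded_closed)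
  have convex: "convex \<Delta>"
    by (auto simp: convex_def \<Delta>_def sum.distrib simp flip: sum_distrib_left)
  have nonempty: "axis undefined 1 \<in> \<Delta>"
    by (simp add: \<Delta>_def axis_def)
  have nng: "g x $ i \<ge> x $ i" if "x \<in> \<Delta>" for x i
    using that nn by (auto simp: g_def \<Delta>_def vector_matrix_mult_def intro!: sum_nonneg)
  have s1: "s x \<ge> 1" if "x \<in> \<Delta>" for x
  proof -
    have "(\<Sum>i\<in>UNIV. x $ i) \<le> s x" unfolding s_def by (intro sum_mono nng that)
    then show ?thesis using that by (simp add: \<Delta>_def)
  qed
  have "continuous_on \<Delta> g" unfolding g_def vector_matrix_mult_def
    by (intro continuous_intros)
  moreover have "continuous_on \<Delta> s" unfolding s_def
    by (intro continuous_intros \<open>continuous_on \<Delta> g\<close>)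
  ultimately have cont: "continuous_on \<Delta> (\<lambda>x. (1 / s x) *\<^sub>R g x)"
    by (intro continuous_intros) (use s1 in force)+
  have self_map: "(\<lambda>x. (1 / s x) *\<^sub>R g x) \<in> \<Delta> \<rightarrow> \<Delta>"
  proof
    fix x assume x: "x \<in> \<Delta>"
    have "0 \<le> g x $ i" for i using nng[OF x, of i] x by (auto simp: \<Delta>_def intro: order_trans)
    moreover have "(\<Sum>i\<in>UNIV. 1 / s x * g x $ i) = 1"
      using s1[OF x] by (simp add: s_def flip: sum_divide_distrib)
    ultimately show "(1 / s x) *\<^sub>R g x \<in> \<Delta>" using s1[OF x] by (simp add: \<Delta>_def)
  qed
  obtain x where x: "x \<in> \<Delta>" and fx: "(1 / s x) *\<^sub>R g x = x"
    using brouwer[OF compact convex _ cont self_map] nonempty by auto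
  have "g x = s x *\<^sub>R ((1 / s x) *\<^sub>R g x)" using s1[OF x] by simp
  then have "g x = s x *\<^sub>R x" by (simp add: fx)
  then have eig: "x v* A = (s x - 1) *\<^sub>R x" by (simp add: g_def algebra_simps)
  have "x \<noteq> 0" "\<And>i. x $ i \<ge> 0" using x by (auto simp: \<Delta>_def)
  then have "x $ i > 0" for i using left_eigenvector_pos[OF nn sc _ _ eig] by simp
  then show ?thesis using eig by (rule that)
qed

text \<open>
  Eigenvectors to distinct eigenvalues are linearly independent. Finiteness is what gives the maximum
  in \<open>spectral_radius\<close> a meaning.
\<close>

lemma finite_complex_spectrum: "finite (complex_spectrum (A :: real ^ 'k::finite ^ 'k))"
proof (rule ccontr)
  assume inf: "infinite (complex_spectrum A)"
  let ?A = "map_matrix complex_of_real A"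
  have "\<forall>z\<in>complex_spectrum A. \<exists>v. v \<noteq> 0 \<and> ?A *v v = z *s v" by (simp add: complex_spectrum_def)
  then obtain v where v: "\<And>z. z \<in> complex_spectrum A \<Longrightarrow> v z \<noteq> 0 \<and> ?A *v v z = z *s v z"
    by metis
  have ind: "\<forall>z\<in>S. c z = 0"
    if "finite S" "S \<subseteq> complex_spectrum A" "(\<Sum>z\<in>S. c z *s v z) = 0" for S and c :: "complex \<Rightarrow> complex"
    using that
  proof (induction S arbitrary: c rule: finite_induct)
    case (insert w S)
    have eq: "(\<Sum>z\<in>S. c z *s v z) + c w *s v w = 0" using insert by (simp add: add.commute)
    have "?A *v ((\<Sum>z\<in>S. c z *s v z) + c w *s v w) = (\<Sum>z\<in>S. (c z * z) *s v z) + (c w * w) *s v w"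
      using insert.prems v
      by (simp add: matrix_vector_right_distrib vec.linear_sum[OF matrix_vector_mul_linear_gen]
          vector_scalar_commute subset_eq)
    then have "(\<Sum>z\<in>S. (c z * z) *s v z) + (c w * w) *s v w = w *s 0" by (simp add: eq)
    also have "\<dots> = (\<Sum>z\<in>S. (c z * w) *s v z) + (c w * w) *s v w"
      unfolding eq[symmetric]
      by (simp add: vec.scale_right_distrib vec.scale_sum_right mult.commute)
    finally have "(\<Sum>z\<in>S. (c z * (z - w)) *s v z) = 0"
      by (simp add: algebra_simps sum_subtractf vec.scale_left_diff_distrib)
    from insert.IH[OF _ this] insert.prems have "\<forall>z\<in>S. c z * (z - w) = 0" by simp
    with insert.hyps have "\<forall>z\<in>S. c z = 0" by auto
    moreover from this eq have "c w *s v w = 0" by (simp add: sum.neutral)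
    with v[of w] insert.prems have "c w = 0" by simp
    ultimately show ?case by simp
  qed simp
  obtain S where S: "S \<subseteq> complex_spectrum A" "finite S" "card S = CARD('k) + 1"
    using infinite_arbitrarily_large[OF inf] by metis
  have inj: "inj_on v S"
  proof (rule inj_onI, rule ccontr)
    fix x y assume xy: "x \<in> S" "y \<in> S" "v x = v y" "x \<noteq> y"
    have "x *s v x = y *s v x" using v[of x] v[of y] xy S by (metis subsetD)
    then have "(x - y) *s v x = 0" by (simp add: vec.scale_left_diff_distrib)
    with xy v[of x] S show False by auto
  qed
  have "vec.independent (v ` S)"
  proof (rule vec.independent_if_scalars_zero)
    fix f x assume f: "(\<Sum>x\<in>v ` S. f x *s x) = 0" and x: "x \<in> v ` S"
    have "(\<Sum>z\<in>S. f (v z) *s v z) = 0" using f by (simp add: sum.reindex[OF inj])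
    from ind[OF S(2,1) this] x show "f x = 0" by auto
  qed (use S in simp)
  then have "card (v ` S) \<le> vec.dim (UNIV :: (complex ^ 'k) set)"
    by (intro vec.independent_card_le_dim) auto
  then show False using S by (simp add: card_image[OF inj] vec.dimension_def card_cart_basis vec.dim_UNIV)
qed

text \<open>
  If $Av = zv$, then $|z| |v| \le A|v|$ coordinatewise; pairing with \<open>x\<close> gives $|z| \le r$. The bound is
  attained, since \<open>r\<close> is an eigenvalue of the transpose of \<open>A\<close> and so of \<open>A\<close>.
\<close>

lemma spectral_radius_eq_left_eigenvalue:
  fixes A :: "real ^ 'k::finite ^ 'k"
  assumes nn: "\<And>i j. A $ i $ j \<ge> 0" and x: "\<And>i. x $ i > 0" "x v* A = r *\<^sub>R x"
  shows "spectral_radius A = r"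
proof -
  let ?A = "map_matrix complex_of_real A"
  have entry: "(\<Sum>i\<in>UNIV. A $ i $ j * x $ i) = r * x $ j" for j
    using arg_cong[OF x(2), of "\<lambda>x. x $ j"] by (simp add: vector_matrix_mult_def mult.commute)
  have r: "r \<ge> 0"
  proof -
    have "0 \<le> (\<Sum>i\<in>UNIV. A $ i $ undefined * x $ i)"
      using nn x(1) by (intro sum_nonneg mult_nonneg_nonneg) (auto simp: less_imp_le)
    then show ?thesis using x(1)[of undefined] by (simp add: entry zero_le_mult_iff)
  qed
  have le: "cmod z \<le> r" if z: "z \<in> complex_spectrum A" for z
  proof -
    obtain v where v: "v \<noteq> 0" "?A *v v = z *s v" using z by (auto simp: complex_spectrum_def)
    have row: "cmod z * cmod (v $ i) \<le> (\<Sum>j\<in>UNIV. A $ i $ j * cmod (v $ j))" for i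
    proof -
      have "z * v $ i = (\<Sum>j\<in>UNIV. complex_of_real (A $ i $ j) * v $ j)"
        using arg_cong[OF v(2), of "\<lambda>x. x $ i"] by (simp add: matrix_vector_mult_def)
      then have "cmod z * cmod (v $ i) = cmod (\<Sum>j\<in>UNIV. complex_of_real (A $ i $ j) * v $ j)"
        by (metis norm_mult)
      also have "\<dots> \<le> (\<Sum>j\<in>UNIV. cmod (complex_of_real (A $ i $ j) * v $ j))" by (rule norm_sum)
      finally show ?thesis using nn by (simp add: norm_mult)
    qed
    have "cmod z * (\<Sum>i\<in>UNIV. x $ i * cmod (v $ i))
      \<le> (\<Sum>i\<in>UNIV. x $ i * (\<Sum>j\<in>UNIV. A $ i $ j * cmod (v $ j)))"
      unfolding sum_distrib_left
      by (intro sum_mono) (use row x(1) in \<open>simp add: mult.left_commute[of "cmod z"] less_imp_le flip: sum_distrib_left\<close>)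
    also have "\<dots> = (\<Sum>j\<in>UNIV. (\<Sum>i\<in>UNIV. A $ i $ j * x $ i) * cmod (v $ j))"
      by (simp add: sum_distrib_left sum_distrib_right mult_ac) (rule sum.swap)
    also have "\<dots> = r * (\<Sum>i\<in>UNIV. x $ i * cmod (v $ i))"
      unfolding entry by (simp add: sum_distrib_left mult_ac)
    finally have *: "cmod z * (\<Sum>i\<in>UNIV. x $ i * cmod (v $ i)) \<le> r * (\<Sum>i\<in>UNIV. x $ i * cmod (v $ i))" .
    obtain i where "v $ i \<noteq> 0" using v(1) by (auto simp: vec_eq_iff)
    then have "0 < (\<Sum>i\<in>UNIV. x $ i * cmod (v $ i))"
      using x(1) by (intro sum_pos2[of _ i]) (auto simp: less_imp_le)
    with * show ?thesis by simp
  qed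
  have "r \<in> cmod ` complex_spectrum A"
  proof -
    have "x \<noteq> 0" using x(1)[of undefined] by auto
    moreover have "transpose (A - r *\<^sub>R mat 1) *v x = 0"
      using x(2) by (simp add: vec_eq_iff matrix_vector_mult_def transpose_def mat_def
          vector_matrix_mult_def algebra_simps sum_subtractf if_distrib[of "(*) _"] cong: if_cong)
    ultimately have "det (A - r *\<^sub>R mat 1) = 0"
      using matrix_left_invertible_ker[of "transpose (A - r *\<^sub>R mat 1)"]
      by (metis det_transpose invertible_det_nz invertible_left_inverse)
    then obtain y where y: "y \<noteq> 0" "(A - r *\<^sub>R mat 1) *v y = 0"
      using matrix_left_invertible_ker[of "A - r *\<^sub>R mat 1"]
      by (metis invertible_det_nz invertible_left_inverse)
    let ?y = "\<chi> i. complex_of_real (y $ i)"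
    have "(\<Sum>j\<in>UNIV. A $ i $ j * y $ j) = r * y $ i" for i
      using arg_cong[OF y(2), of "\<lambda>x. x $ i"]
      by (simp add: matrix_vector_mult_def mat_def algebra_simps sum_subtractf
          if_distrib[of "(*) _"] cong: if_cong)
    then have "?A *v ?y = complex_of_real r *s ?y"
      by (simp add: vec_eq_iff matrix_vector_mult_def flip: of_real_mult of_real_sum)
    moreover have "?y \<noteq> 0" using y(1) by (simp add: vec_eq_iff)
    ultimately have "complex_of_real r \<in> complex_spectrum A" unfolding complex_spectrum_def by blast
    then show ?thesis using r by force
  qed
  then show ?thesis unfolding spectral_radius_def
    using le finite_complex_spectrum by (intro Max_eqI) auto
qed

section \<open>Subgradients and convexity of \<open>chi_map\<close>\<close>

definition rvec :: "nat ^ 'k \<Rightarrow> real ^ 'k" where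
  "rvec k = (\<chi> j. real (k $ j))"

lemma rvec_nth [simp]: "rvec k $ j = real (k $ j)"
  by (simp add: rvec_def)

lemma inner_rvec: "\<theta> \<bullet> rvec k = (\<Sum>j\<in>UNIV. \<theta> $ j * real (k $ j))"
  by (simp add: inner_vec_def)

text \<open>
  For the weights \<open>pmf (\<mu> i)\<close> this is $\phi^{(i)}(e^\theta)$, and for $k_j \mu^{(i)}(k)$ it is the
  derivative of $\phi^{(i)}(e^\theta)$ with respect to $\theta_j$.
\<close>

definition laplace :: "(nat ^ 'k \<Rightarrow> real) \<Rightarrow> real ^ 'k::finite \<Rightarrow> real" where
  "laplace c \<theta> = (\<Sum>\<^sub>\<infinity>k. c k * exp (\<theta> \<bullet> rvec k))"

definition entire_weight :: "(nat ^ 'k::finite \<Rightarrow> real) \<Rightarrow> bool" where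
  "entire_weight c \<longleftrightarrow> (\<forall>k. c k \<ge> 0) \<and> (\<forall>\<theta>. (\<lambda>k. c k * exp (\<theta> \<bullet> rvec k)) summable_on UNIV)"

lemma has_sum_laplace:
  "entire_weight c \<Longrightarrow> ((\<lambda>k. c k * exp (\<theta> \<bullet> rvec k)) has_sum laplace c \<theta>) UNIV"
  by (simp add: entire_weight_def laplace_def)

lemma gen_fun_exp_vec: "gen_fun \<mu> i (exp_vec \<theta>) = laplace (pmf (\<mu> i)) \<theta>"
  by (simp add: gen_fun_def laplace_def monomial_exp_vec inner_rvec)

lemma entire_weight_pmf: "entire_proj \<mu> \<Longrightarrow> entire_weight (pmf (\<mu> i))"
  using summable_gen_fun[of \<mu> i "exp_vec _"]
  by (simp add: entire_weight_def monomial_exp_vec inner_rvec)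

text \<open>
  The factor $k_j \le e^{k_j}$ is absorbed by a shift of \<open>\<theta>\<close> by the unit vector \<open>j\<close>.
\<close>

lemma entire_weight_moment:
  assumes "entire_weight c"
  shows "entire_weight (\<lambda>k. real (k $ j) * c k)"
  unfolding entire_weight_def
proof (intro conjI allI)
  show "0 \<le> real (k $ j) * c k" for k using assms by (simp add: entire_weight_def)
  fix \<theta> :: "real ^ 'a"
  have c0: "c k \<ge> 0" for k using assms by (simp add: entire_weight_def)
  show "(\<lambda>k. real (k $ j) * c k * exp (\<theta> \<bullet> rvec k)) summable_on UNIV"
  proof (rule summable_on_comparison_test)
    show "(\<lambda>k. c k * exp ((\<theta> + axis j 1) \<bullet> rvec k)) summable_on UNIV"
      using assms by (simp add: entire_weight_def)
    fix k
    have "real (k $ j) \<le> exp (real (k $ j))"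
      using exp_ge_add_one_self[of "real (k $ j)"] by linarith
    then have "c k * exp (\<theta> \<bullet> rvec k) * real (k $ j) \<le> c k * exp (\<theta> \<bullet> rvec k) * exp (real (k $ j))"
      by (intro mult_left_mono) (simp_all add: c0)
    then show "real (k $ j) * c k * exp (\<theta> \<bullet> rvec k) \<le> c k * exp ((\<theta> + axis j 1) \<bullet> rvec k)"
      by (simp add: inner_add_left exp_add inner_axis' mult_ac)
  qed (simp add: c0)
qed

text \<open>
  A nonnegative combination of the convex functions $e^{\theta \cdot k}$. Since finite convex functions
  are continuous, this yields the continuity of the tilted means without differentiating series.
\<close>

lemma convex_laplace:
  assumes "entire_weight c"
  shows "convex_on UNIV (laplace c)"
proof (rule convex_onI)
  fix t :: real and x y :: "real ^ 'a"
  assume t: "0 < t" "t < 1"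
  have c0: "c k \<ge> 0" for k using assms by (simp add: entire_weight_def)
  show "laplace c ((1 - t) *\<^sub>R x + t *\<^sub>R y) \<le> (1 - t) * laplace c x + t * laplace c y"
  proof (rule has_sum_mono)
    show "((\<lambda>k. c k * exp (((1 - t) *\<^sub>R x + t *\<^sub>R y) \<bullet> rvec k)) has_sum
        laplace c ((1 - t) *\<^sub>R x + t *\<^sub>R y)) UNIV"
      by (rule has_sum_laplace[OF assms])
    show "((\<lambda>k. (1 - t) * (c k * exp (x \<bullet> rvec k)) + t * (c k * exp (y \<bullet> rvec k))) has_sum
        (1 - t) * laplace c x + t * laplace c y) UNIV"
      by (intro has_sum_add has_sum_cmult_right has_sum_laplace assms)
    fix k
    have "exp ((1 - t) * (x \<bullet> rvec k) + t * (y \<bullet> rvec k))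
        \<le> (1 - t) * exp (x \<bullet> rvec k) + t * exp (y \<bullet> rvec k)"
      using convex_onD[OF exp_convex, of t "x \<bullet> rvec k" "y \<bullet> rvec k"] t by simp
    from mult_left_mono[OF this c0[of k]]
    show "c k * exp (((1 - t) *\<^sub>R x + t *\<^sub>R y) \<bullet> rvec k)
        \<le> (1 - t) * (c k * exp (x \<bullet> rvec k)) + t * (c k * exp (y \<bullet> rvec k))"
      by (simp add: inner_add_left algebra_simps)
  qed
qed simp

lemma continuous_laplace: "entire_weight c \<Longrightarrow> continuous_on UNIV (laplace c)"
  by (rule convex_on_continuous[OF open_UNIV convex_laplace])

abbreviation tilted_mean :: "'k::finite projection \<Rightarrow> real ^ 'k \<Rightarrow> real ^ 'k ^ 'k" where
  "tilted_mean \<mu> \<theta> \<equiv> mean_matrix (tilt \<mu> \<theta>)"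

lemma laplace_pos: "entire_proj \<mu> \<Longrightarrow> laplace (pmf (\<mu> i)) \<theta> > 0"
  using gen_fun_exp_pos[of \<mu> i \<theta>] by (simp add: gen_fun_exp_vec)

lemma tilted_mean_eq:
  assumes "entire_proj \<mu>"
  shows "tilted_mean \<mu> \<theta> $ i $ j =
    laplace (\<lambda>k. real (k $ j) * pmf (\<mu> i) k) \<theta> / laplace (pmf (\<mu> i)) \<theta>"
proof -
  have "((\<lambda>k. real (k $ j) * pmf (\<mu> i) k * exp (\<theta> \<bullet> rvec k) * (1 / laplace (pmf (\<mu> i)) \<theta>)) has_sum
    laplace (\<lambda>k. real (k $ j) * pmf (\<mu> i) k) \<theta> * (1 / laplace (pmf (\<mu> i)) \<theta>)) UNIV"
    by (intro has_sum_cmult_left has_sum_laplace entire_weight_moment entire_weight_pmf assms)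
  then show ?thesis
    by (simp add: mean_matrix_def pmf_tilt[OF assms] gen_fun_exp_vec mult.assoc infsumI
        flip: inner_rvec)
qed

lemma mean_matrix_nonneg: "mean_matrix \<mu> $ i $ j \<ge> 0"
  by (simp add: mean_matrix_def infsum_nonneg)

lemma continuous_tilted_mean:
  "entire_proj \<mu> \<Longrightarrow> continuous_on UNIV (\<lambda>\<theta>. tilted_mean \<mu> \<theta> $ i $ j)"
  unfolding tilted_mean_eq using laplace_pos
  by (intro continuous_intros continuous_laplace entire_weight_moment entire_weight_pmf)
     (auto simp: less_le)

lemma mean_matrix_posD:
  assumes "mean_matrix \<mu> $ i $ j > 0"
  obtains k where "k \<in> set_pmf (\<mu> i)" "k $ j > 0"
proof -
  have "\<exists>k. real (k $ j) * pmf (\<mu> i) k \<noteq> 0"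
  proof (rule ccontr)
    assume "\<not> ?thesis"
    then have "mean_matrix \<mu> $ i $ j = 0" unfolding mean_matrix_def by (simp add: infsum_0)
    with assms show False by simp
  qed
  then obtain k where "real (k $ j) * pmf (\<mu> i) k \<noteq> 0" by blast
  then show ?thesis using that[of k] by (auto simp: set_pmf_iff)
qed

lemma tilted_mean_posI:
  assumes "entire_proj \<mu>" "k \<in> set_pmf (\<mu> i)" "k $ j > 0"
  shows "tilted_mean \<mu> \<theta> $ i $ j > 0"
proof -
  let ?f = "\<lambda>k. real (k $ j) * pmf (\<mu> i) k * exp (\<theta> \<bullet> rvec k)"
  have "(?f has_sum laplace (\<lambda>k. real (k $ j) * pmf (\<mu> i) k) \<theta>) UNIV"
    by (intro has_sum_laplace entire_weight_moment entire_weight_pmf assms)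
  moreover have "(?f has_sum ?f k) {k}" by (simp add: has_sum_finiteI)
  ultimately have "?f k \<le> laplace (\<lambda>k. real (k $ j) * pmf (\<mu> i) k) \<theta>"
    using has_sum_mono2[of ?f "{k}" _ UNIV] by simp
  moreover have "?f k > 0" using assms by (simp add: pmf_positive)
  ultimately show ?thesis by (simp add: tilted_mean_eq[OF assms(1)] laplace_pos[OF assms(1)])
qed

lemma strongly_connected_mean_matrix:
  "irreducible_proj \<mu> \<Longrightarrow> strongly_connected (mean_matrix \<mu>)"
  by (intro strongly_connectedI_power mean_matrix_nonneg) (auto simp: irreducible_proj_def)

text \<open>
  Tilting multiplies each weight by a positive factor and hence preserves the supports.
\<close>

lemma strongly_connected_tilted_mean:
  assumes "entire_proj \<mu>" "irreducible_proj \<mu>"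
  shows "strongly_connected (tilted_mean \<mu> \<theta>)"
proof -
  show ?thesis
    using strongly_connected_mean_matrix[OF assms(2)]
    unfolding strongly_connected_def
    by (meson mean_matrix_posD tilted_mean_posI[OF assms(1)])
qed

lemma has_sum_finite_sum:
  fixes f :: "'a \<Rightarrow> 'b \<Rightarrow> real"
  assumes "finite I" "\<And>i. i \<in> I \<Longrightarrow> (f i has_sum s i) A"
  shows "((\<lambda>x. \<Sum>i\<in>I. f i x) has_sum (\<Sum>i\<in>I. s i)) A"
  using assms by (induction I rule: finite_induct) (simp_all add: has_sum_add)

lemma exp_eq_add_one_iff: "exp x = 1 + x \<longleftrightarrow> x = (0::real)"
  using ln_eq_minus_one[of "exp x"] by auto

text \<open>
  Jensen's inequality for $e^{d \cdot k}$ under the tilted law of type \<open>i\<close>, where $d \cdot k$ has mean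
  $m = (M_\theta d)_i$. It is the sum over \<open>k\<close> of the tangent inequality $e^x \ge e^m (1 + x - m)$ at
  $x = d \cdot k$, and equality in the sum forces equality in every term.
\<close>

lemma laplace_jensen:
  assumes "entire_proj \<mu>"
  defines "m \<equiv> (\<lambda>\<theta> d i. (tilted_mean \<mu> \<theta> *v d) $ i)"
  shows "laplace (pmf (\<mu> i)) \<theta> * exp (m \<theta> d i) \<le> laplace (pmf (\<mu> i)) (\<theta> + d)"
    and "laplace (pmf (\<mu> i)) \<theta> * exp (m \<theta> d i) = laplace (pmf (\<mu> i)) (\<theta> + d) \<Longrightarrow>
      k \<in> set_pmf (\<mu> i) \<Longrightarrow> d \<bullet> rvec k = m \<theta> d i"
proof -
  let ?F = "laplace (pmf (\<mu> i))" and ?m = "m \<theta> d i"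
  let ?a = "\<lambda>k. pmf (\<mu> i) k * exp (\<theta> \<bullet> rvec k)"
  define b where "b k = ?a k * (exp (d \<bullet> rvec k) - exp ?m * (1 + (d \<bullet> rvec k - ?m)))" for k
  have w: "entire_weight (pmf (\<mu> i))" by (rule entire_weight_pmf[OF assms(1)])
  have "((\<lambda>k. \<Sum>j\<in>UNIV. d $ j * (real (k $ j) * pmf (\<mu> i) k * exp (\<theta> \<bullet> rvec k))) has_sum
      (\<Sum>j\<in>UNIV. d $ j * laplace (\<lambda>k. real (k $ j) * pmf (\<mu> i) k) \<theta>)) UNIV"
    by (intro has_sum_finite_sum has_sum_cmult_right has_sum_laplace entire_weight_moment w) simp
  also have "(\<lambda>k. \<Sum>j\<in>UNIV. d $ j * (real (k $ j) * pmf (\<mu> i) k * exp (\<theta> \<bullet> rvec k))) =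
      (\<lambda>k. (d \<bullet> rvec k) * ?a k)"
    by (simp add: inner_rvec[of d] sum_distrib_left mult_ac)
  also have "(\<Sum>j\<in>UNIV. d $ j * laplace (\<lambda>k. real (k $ j) * pmf (\<mu> i) k) \<theta>) = ?F \<theta> * ?m"
    using laplace_pos[OF assms(1), of i \<theta>]
    by (simp add: m_def matrix_vector_mult_def tilted_mean_eq[OF assms(1)] sum_distrib_left mult_ac)
  finally have first: "((\<lambda>k. (d \<bullet> rvec k) * ?a k) has_sum ?F \<theta> * ?m) UNIV" .
  have "((\<lambda>k. pmf (\<mu> i) k * exp ((\<theta> + d) \<bullet> rvec k)
          + (- exp ?m) * (?a k + ((d \<bullet> rvec k) * ?a k + (- ?m) * ?a k)))
        has_sum ?F (\<theta> + d) + (- exp ?m) * (?F \<theta> + (?F \<theta> * ?m + (- ?m) * ?F \<theta>))) UNIV"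
    by (intro has_sum_add has_sum_cmult_right first has_sum_laplace w)
  also have "(\<lambda>k. pmf (\<mu> i) k * exp ((\<theta> + d) \<bullet> rvec k)
          + (- exp ?m) * (?a k + ((d \<bullet> rvec k) * ?a k + (- ?m) * ?a k))) = b"
    by (simp add: b_def fun_eq_iff inner_add_left exp_add algebra_simps)
  finally have b_sum: "(b has_sum ?F (\<theta> + d) - ?F \<theta> * exp ?m) UNIV"
    by (simp add: mult_ac)
  have b_eq: "b k = ?a k * (exp ?m * (exp (d \<bullet> rvec k - ?m) - (1 + (d \<bullet> rvec k - ?m))))" for k
    by (simp add: b_def exp_diff algebra_simps)
  have b_nonneg: "b k \<ge> 0" for k
    unfolding b_eq using exp_ge_add_one_self[of "d \<bullet> rvec k - ?m"]
    by (intro mult_nonneg_nonneg) auto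
  show "?F \<theta> * exp ?m \<le> ?F (\<theta> + d)"
    using has_sum_nonneg[OF b_sum] b_nonneg by simp
  assume eq: "?F \<theta> * exp ?m = ?F (\<theta> + d)" and k: "k \<in> set_pmf (\<mu> i)"
  have "b k = 0"
    using nonneg_has_sum_le_0D[OF b_sum, of k] eq b_nonneg by simp
  then have "exp (d \<bullet> rvec k - ?m) = 1 + (d \<bullet> rvec k - ?m)"
    using k by (simp add: b_eq set_pmf_iff)
  then show "d \<bullet> rvec k = ?m" by (simp only: exp_eq_add_one_iff)
qed

lemma chi_map_nth: "chi_map \<mu> \<theta> $ i = ln (laplace (pmf (\<mu> i)) \<theta>) - \<theta> $ i"
  by (simp add: chi_map_def gen_fun_exp_vec)

text \<open>
  The logarithm of \<open>laplace_jensen\<close>: row \<open>i\<close> of $M_\theta - I$ is a subgradient of $\chi_i$ at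
  \<open>\<theta>\<close>, and the supporting hyperplane touches the graph at $\theta + d$ only if $d \cdot k$ is constant
  on the support of $\mu^{(i)}$.
\<close>

lemma chi_map_subgradient:
  assumes "entire_proj \<mu>"
  shows "chi_map \<mu> \<theta> $ i + (tilted_mean \<mu> \<theta> *v d - d) $ i \<le> chi_map \<mu> (\<theta> + d) $ i"
    and "chi_map \<mu> \<theta> $ i + (tilted_mean \<mu> \<theta> *v d - d) $ i = chi_map \<mu> (\<theta> + d) $ i \<Longrightarrow>
      k \<in> set_pmf (\<mu> i) \<Longrightarrow> d \<bullet> rvec k = (tilted_mean \<mu> \<theta> *v d) $ i"
proof -
  let ?F = "laplace (pmf (\<mu> i))" and ?m = "(tilted_mean \<mu> \<theta> *v d) $ i"
  have pos: "?F \<eta> > 0" for \<eta> by (rule laplace_pos[OF assms])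
  have ln_eq: "ln (?F \<theta> * exp ?m) = ln (?F \<theta>) + ?m" using pos[of \<theta>] by (simp add: ln_mult)
  have "ln (?F \<theta>) + ?m \<le> ln (?F (\<theta> + d))"
    unfolding ln_eq[symmetric] using laplace_jensen(1)[OF assms] pos[of \<theta>] pos[of "\<theta> + d"]
    by (subst ln_le_cancel_iff) auto
  then show "chi_map \<mu> \<theta> $ i + (tilted_mean \<mu> \<theta> *v d - d) $ i \<le> chi_map \<mu> (\<theta> + d) $ i"
    by (simp add: chi_map_nth)
  assume eq: "chi_map \<mu> \<theta> $ i + (tilted_mean \<mu> \<theta> *v d - d) $ i = chi_map \<mu> (\<theta> + d) $ i"
    and k: "k \<in> set_pmf (\<mu> i)"
  have "ln (?F \<theta> * exp ?m) = ln (?F (\<theta> + d))"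
    using eq by (simp add: chi_map_nth ln_eq)
  then have "?F \<theta> * exp ?m = ?F (\<theta> + d)"
    using pos[of \<theta>] pos[of "\<theta> + d"] by simp
  from laplace_jensen(2)[OF assms this k] show "d \<bullet> rvec k = ?m" .
qed

lemma inner_chi_map_subgradient:
  assumes "entire_proj \<mu>" "\<And>i. Z $ i \<ge> 0"
  shows "Z \<bullet> chi_map \<mu> \<theta> + Z \<bullet> (tilted_mean \<mu> \<theta> *v d - d) \<le> Z \<bullet> chi_map \<mu> (\<theta> + d)"
proof -
  have "Z \<bullet> (chi_map \<mu> \<theta> + (tilted_mean \<mu> \<theta> *v d - d)) \<le> Z \<bullet> chi_map \<mu> (\<theta> + d)"
    unfolding inner_vec_def
  proof (rule sum_mono)
    show "Z $ i \<bullet> (chi_map \<mu> \<theta> + (tilted_mean \<mu> \<theta> *v d - d)) $ i \<le> Z $ i \<bullet> chi_map \<mu> (\<theta> + d) $ i" for i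
      using mult_left_mono[OF chi_map_subgradient(1)[OF assms(1), of \<theta> i d] assms(2)[of i]] by simp
  qed
  then show ?thesis by (simp only: inner_add_right)
qed

text \<open>
  The linear terms of the subgradient inequalities cancel when weighted by \<open>Z\<close>. Nonlocalization provides
  a coordinate, weighted with $Z_i > 0$, in which the inequality is strict.
\<close>

lemma fixed_left_eigenvector_strict_min:
  assumes "entire_proj \<mu>" "nonlocalized_proj \<mu>" "\<And>i. Z $ i > 0"
    and Z: "Z v* tilted_mean \<mu> \<theta> = Z" and "\<eta> \<noteq> \<theta>"
  shows "Z \<bullet> chi_map \<mu> \<theta> < Z \<bullet> chi_map \<mu> \<eta>"
proof -
  define d where "d = \<eta> - \<theta>"
  have "d \<noteq> 0" using assms(5) by (simp add: d_def)
  with assms(2) obtain i where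
    i: "\<nexists>c. AE k in measure_pmf (\<mu> i). (\<Sum>j\<in>UNIV. d $ j * real (k $ j)) = c"
    unfolding nonlocalized_proj_def by blast
  have "Z \<bullet> (tilted_mean \<mu> \<theta> *v d - d) = 0"
    by (simp add: inner_diff_right dot_lmul_matrix[symmetric] Z)
  then have "Z \<bullet> chi_map \<mu> \<theta> = Z \<bullet> (chi_map \<mu> \<theta> + (tilted_mean \<mu> \<theta> *v d - d))"
    by (simp add: inner_add_right)
  also have "\<dots> < Z \<bullet> chi_map \<mu> (\<theta> + d)"
    unfolding inner_vec_def
  proof (rule sum_strict_mono_ex1)
    have "chi_map \<mu> \<theta> $ i + (tilted_mean \<mu> \<theta> *v d - d) $ i \<noteq> chi_map \<mu> (\<theta> + d) $ i"
      using chi_map_subgradient(2)[OF assms(1), of \<theta> i d] i by (auto simp: AE_measure_pmf_iff inner_rvec)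
    with chi_map_subgradient(1)[OF assms(1), of \<theta> i d] assms(3)[of i]
    show "\<exists>i\<in>UNIV. Z $ i \<bullet> (chi_map \<mu> \<theta> + (tilted_mean \<mu> \<theta> *v d - d)) $ i < Z $ i \<bullet> chi_map \<mu> (\<theta> + d) $ i"
      by (intro bexI[of _ i]) (auto simp: less_le)
    show "\<forall>i\<in>UNIV. Z $ i \<bullet> (chi_map \<mu> \<theta> + (tilted_mean \<mu> \<theta> *v d - d)) $ i \<le> Z $ i \<bullet> chi_map \<mu> (\<theta> + d) $ i"
      using chi_map_subgradient(1)[OF assms(1), of \<theta> _ d] assms(3) by simp
  qed auto
  finally show ?thesis by (simp add: d_def)
qed

text \<open>
  A function with a subgradient at every point is convex.
\<close>

lemma convex_chi_map:
  assumes "entire_proj \<mu>"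
  shows "convex_on UNIV (\<lambda>\<theta>. chi_map \<mu> \<theta> $ i)"
proof (rule convex_onI)
  fix t :: real and x y :: "real ^ 'a"
  assume t: "0 < t" "t < 1"
  define z where "z = (1 - t) *\<^sub>R x + t *\<^sub>R y"
  define L where "L d = (tilted_mean \<mu> z *v d - d) $ i" for d
  have "(1 - t) * (chi_map \<mu> z $ i + L (x - z)) + t * (chi_map \<mu> z $ i + L (y - z))
      \<le> (1 - t) * chi_map \<mu> x $ i + t * chi_map \<mu> y $ i"
    using chi_map_subgradient(1)[OF assms, of z i "x - z"] chi_map_subgradient(1)[OF assms, of z i "y - z"] t
    by (intro add_mono mult_left_mono) (auto simp: L_def)
  moreover have "(1 - t) * L (x - z) + t * L (y - z) = 0"
  proof -
    have "(1 - t) * L (x - z) + t * L (y - z) = L ((1 - t) *\<^sub>R (x - z) + t *\<^sub>R (y - z))"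
      by (simp add: L_def matrix_vector_right_distrib matrix_vector_mult_scaleR algebra_simps)
    also have "(1 - t) *\<^sub>R (x - z) + t *\<^sub>R (y - z) = 0"
      by (simp add: z_def algebra_simps)
    finally show ?thesis by (simp add: L_def)
  qed
  moreover have "(1 - t) * (chi_map \<mu> z $ i + L (x - z)) + t * (chi_map \<mu> z $ i + L (y - z))
      = chi_map \<mu> z $ i + ((1 - t) * L (x - z) + t * L (y - z))"
    by (simp add: algebra_simps)
  ultimately show "chi_map \<mu> ((1 - t) *\<^sub>R x + t *\<^sub>R y) $ i
      \<le> (1 - t) * chi_map \<mu> x $ i + t * chi_map \<mu> y $ i"
    unfolding z_def[symmetric] by linarith
qed simp

lemma continuous_chi_map:
  assumes "entire_proj \<mu>"
  shows "continuous_on S (chi_map \<mu>)"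
proof -
  have "continuous_on UNIV (\<lambda>\<theta>. \<chi> i. chi_map \<mu> \<theta> $ i)"
    by (intro continuous_on_vec_lambda convex_on_continuous open_UNIV convex_chi_map assms)
  then show ?thesis by (auto intro: continuous_on_subset)
qed

text \<open>
  A first-order optimality condition. Constant weights \<open>a\<close> cover the minimizers of $Z \cdot \chi$;
  the weights $e^{\chi_i}$ cover the minimizers of $\sum_i e^{\chi_i}$, because $e^x$ is convex. Only the
  subgradient inequality at points $\theta + t v$ with $t \to 0^+$ and the continuity of the tilted means
  enter.
\<close>

lemma fixed_left_eigenvectorI:
  fixes a :: "real ^ 'k::finite \<Rightarrow> real ^ 'k"
  assumes "entire_proj \<mu>" and a: "continuous_on UNIV a" "\<And>\<eta> i. a \<eta> $ i \<ge> 0"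
    and le: "\<And>\<eta>. a \<eta> \<bullet> chi_map \<mu> \<theta> \<le> a \<eta> \<bullet> chi_map \<mu> \<eta>"
  shows "a \<theta> v* tilted_mean \<mu> \<theta> = a \<theta>"
proof -
  \<comment> \<open>The limit of the subgradient inequality at \<open>\<theta> + t *\<^sub>R v\<close>, evaluated at \<open>\<theta>\<close>.\<close>
  have nonneg: "a \<theta> \<bullet> (tilted_mean \<mu> \<theta> *v v - v) \<ge> 0" for v
  proof -
    define G where "G t = a (\<theta> + t *\<^sub>R v) \<bullet> (tilted_mean \<mu> (\<theta> + t *\<^sub>R v) *v v - v)" for t
    have G: "G t \<ge> 0" if "t > 0" for t
    proof -
      let ?\<eta> = "\<theta> + t *\<^sub>R v"
      have "a ?\<eta> \<bullet> chi_map \<mu> ?\<eta> + a ?\<eta> \<bullet> (tilted_mean \<mu> ?\<eta> *v ((-t) *\<^sub>R v) - (-t) *\<^sub>R v)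
        \<le> a ?\<eta> \<bullet> chi_map \<mu> (?\<eta> + (-t) *\<^sub>R v)"
        by (rule inner_chi_map_subgradient[OF assms(1) a(2)])
      also have "\<dots> \<le> a ?\<eta> \<bullet> chi_map \<mu> ?\<eta>" using le[of ?\<eta>] by simp
      finally have "0 \<le> t * G t"
        by (simp add: G_def matrix_vector_mult_scaleR inner_diff_right algebra_simps del: scaleR_minus_left)
      with that show ?thesis by (simp add: zero_le_mult_iff)
    qed
    have "continuous_on UNIV G"
      unfolding G_def matrix_vector_mult_def
      by (intro continuous_intros continuous_on_vec_lambda continuous_on_compose2[OF a(1)]
          continuous_on_compose2[OF continuous_tilted_mean[OF assms(1)]]) auto
    then have "(G \<longlongrightarrow> G 0) (at_right 0)"
      using tendsto_within_subset[of G _ 0 UNIV "{0<..}"] by (simp add: continuous_on_def)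
    then have "0 \<le> G 0"
      by (rule tendsto_lowerbound)
         (use G in \<open>auto intro: eventually_mono[OF eventually_at_right_less]\<close>)
    then show ?thesis by (simp add: G_def)
  qed
  have "(a \<theta> v* tilted_mean \<mu> \<theta> - a \<theta>) \<bullet> v = 0" for v
    using nonneg[of v] nonneg[of "- v"] matrix_vector_mult_scaleR[of "tilted_mean \<mu> \<theta>" "-1" v]
    by (simp add: inner_diff_left inner_diff_right dot_lmul_matrix)
  then have "a \<theta> v* tilted_mean \<mu> \<theta> - a \<theta> = 0" using inner_eq_zero_iff by blast
  then show ?thesis by simp
qed

section \<open>Convex functions of linear growth\<close>

text \<open>
  Along each ray from \<open>x\<^sub>0\<close> the difference quotients of a convex function increase, so the minimal excess
  over the unit sphere is a lower bound for the slope outside the ball.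
\<close>

lemma convex_linear_growth:
  fixes f :: "'a::euclidean_space \<Rightarrow> real"
  assumes f: "convex_on UNIV f" and x\<^sub>0: "\<And>x. x \<in> sphere x\<^sub>0 1 \<Longrightarrow> f x\<^sub>0 < f x"
  obtains \<delta> C where "\<delta> > 0" "\<And>x. \<delta> * norm x - C \<le> f x"
proof -
  have cont: "continuous_on S f" for S
    using convex_on_continuous[OF open_UNIV f] by (rule continuous_on_subset) simp
  obtain p where p: "p \<in> sphere x\<^sub>0 1" "\<And>x. x \<in> sphere x\<^sub>0 1 \<Longrightarrow> f p \<le> f x"
    using continuous_attains_inf[OF compact_sphere _ cont, of x\<^sub>0 1] by auto
  obtain q where q: "\<And>x. x \<in> cball x\<^sub>0 1 \<Longrightarrow> f q \<le> f x"
    using continuous_attains_inf[OF compact_cball _ cont, of x\<^sub>0 1] by (metis cball_eq_empty not_one_less_zero)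
  define \<delta> where "\<delta> = f p - f x\<^sub>0"
  have \<delta>: "\<delta> > 0" using x\<^sub>0[OF p(1)] by (simp add: \<delta>_def)
  show ?thesis
  proof (rule that[OF \<delta>])
    fix x
    define r where "r = norm (x - x\<^sub>0)"
    have rx: "norm x \<le> norm x\<^sub>0 + r" unfolding r_def using norm_triangle_sub[of x x\<^sub>0] by simp
    show "\<delta> * norm x - (\<delta> * (1 + norm x\<^sub>0) + \<bar>f x\<^sub>0\<bar> + \<bar>f q\<bar>) \<le> f x"
    proof (cases "r \<le> 1")
      case True
      then have "f q \<le> f x" by (intro q) (simp add: r_def dist_norm norm_minus_commute)
      moreover have "\<delta> * norm x \<le> \<delta> * (1 + norm x\<^sub>0)" using rx True \<delta> by (intro mult_left_mono) auto
      ultimately show ?thesis by (simp add: algebra_simps)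
    next
      case False
      \<comment> \<open>The point in which the segment from \<open>x\<^sub>0\<close> to \<open>x\<close> meets the sphere.\<close>
      define y where "y = (1 - 1 / r) *\<^sub>R x\<^sub>0 + (1 / r) *\<^sub>R x"
      have "y - x\<^sub>0 = (1 / r) *\<^sub>R (x - x\<^sub>0)" by (simp add: y_def algebra_simps)
      then have "norm (y - x\<^sub>0) = 1" using False by (auto simp: r_def)
      then have "f p \<le> f y" by (intro p(2)) (simp add: dist_norm norm_minus_commute)
      also have "f y \<le> (1 - 1 / r) * f x\<^sub>0 + (1 / r) * f x"
        unfolding y_def using False by (intro convex_onD[OF f]) auto
      finally have "r * f p \<le> r * ((1 - 1 / r) * f x\<^sub>0 + (1 / r) * f x)"
        using False by (intro mult_left_mono) auto
      also have "\<dots> = (r - 1) * f x\<^sub>0 + f x" using False by (simp add: field_simps)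
      finally have "f x\<^sub>0 + r * \<delta> \<le> f x" by (simp add: \<delta>_def algebra_simps)
      moreover have "\<delta> * norm x \<le> \<delta> * (norm x\<^sub>0 + r)" using rx \<delta> by (intro mult_left_mono) auto
      ultimately show ?thesis using \<delta> by (simp add: algebra_simps)
    qed
  qed
qed

lemma linear_growth_attains_min:
  fixes f :: "'a::euclidean_space \<Rightarrow> real"
  assumes "continuous_on UNIV f" "\<delta> > 0" "\<And>x. \<delta> * norm x - C \<le> f x"
  obtains x where "\<And>y. f x \<le> f y"
proof -
  let ?K = "{x. f x \<le> f 0}"
  have "closed ?K" by (intro closed_Collect_le assms continuous_on_const)
  moreover have "?K \<subseteq> cball 0 ((f 0 + C) / \<delta>)"
  proof
    fix x assume "x \<in> ?K"
    then have "\<delta> * norm x \<le> f 0 + C" using assms(3)[of x] by simp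
    then show "x \<in> cball 0 ((f 0 + C) / \<delta>)" using assms(2) by (simp add: field_simps)
  qed
  ultimately have "compact ?K"
    using bounded_subset[OF bounded_cball] by (simp add: compact_eq_bounded_closed)
  moreover have "0 \<in> ?K" by simp
  ultimately obtain x where x: "x \<in> ?K" "\<And>y. y \<in> ?K \<Longrightarrow> f x \<le> f y"
    using continuous_attains_inf[of ?K f] continuous_on_subset[OF assms(1)] by blast
  have "f x \<le> f y" for y using x(1) x(2)[of y] by (cases "y \<in> ?K") auto
  then show ?thesis by (rule that)
qed

section \<open>The asymptotic cone as a set of coercive weights\<close>

lemma convex_inner_chi_map:
  assumes "entire_proj \<mu>" "\<And>i. Z $ i \<ge> 0"
  shows "convex_on UNIV (\<lambda>\<theta>. Z \<bullet> chi_map \<mu> \<theta>)"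
proof (rule convex_onI)
  fix t :: real and x y :: "real ^ 'a"
  assume t: "0 < t" "t < 1"
  have "Z $ i * chi_map \<mu> ((1 - t) *\<^sub>R x + t *\<^sub>R y) $ i
      \<le> Z $ i * ((1 - t) * chi_map \<mu> x $ i + t * chi_map \<mu> y $ i)" for i
    using convex_onD[OF convex_chi_map[OF assms(1)], of t x y i] t assms(2)
    by (intro mult_left_mono) auto
  then have "Z \<bullet> chi_map \<mu> ((1 - t) *\<^sub>R x + t *\<^sub>R y)
      \<le> (\<Sum>i\<in>UNIV. Z $ i * ((1 - t) * chi_map \<mu> x $ i + t * chi_map \<mu> y $ i))"
    unfolding inner_vec_def inner_real_def by (rule sum_mono)
  also have "\<dots> = (1 - t) * (Z \<bullet> chi_map \<mu> x) + t * (Z \<bullet> chi_map \<mu> y)"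
    by (simp add: inner_vec_def sum_distrib_left sum.distrib[symmetric] algebra_simps)
  finally show "Z \<bullet> chi_map \<mu> ((1 - t) *\<^sub>R x + t *\<^sub>R y)
      \<le> (1 - t) * (Z \<bullet> chi_map \<mu> x) + t * (Z \<bullet> chi_map \<mu> y)" .
qed simp

lemma minimizer_imp_fixed_left_eigenvector:
  assumes "entire_proj \<mu>" "irreducible_proj \<mu>" "\<And>i. Z $ i \<ge> 0" "Z \<noteq> 0"
    and "\<And>\<eta>. Z \<bullet> chi_map \<mu> \<theta> \<le> Z \<bullet> chi_map \<mu> \<eta>"
  shows "Z v* tilted_mean \<mu> \<theta> = Z" "Z $ i > 0"
proof -
  show eig: "Z v* tilted_mean \<mu> \<theta> = Z"
    using fixed_left_eigenvectorI[of \<mu> "\<lambda>_. Z" \<theta>] assms by simp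
  show "Z $ i > 0"
    using left_eigenvector_pos[OF mean_matrix_nonneg strongly_connected_tilted_mean, of \<mu> Z \<theta> 1 i]
      assms eig by simp
qed

lemma asy_dir_eq:
  assumes "entire_proj \<mu>" "irreducible_proj \<mu>" "\<And>i. Z $ i > 0" "Z v* tilted_mean \<mu> \<theta> = Z"
  shows "asy_dir \<mu> \<theta> = (1 / (\<Sum>i\<in>UNIV. Z $ i)) *\<^sub>R Z"
  unfolding asy_dir_def
proof (rule the_equality)
  let ?s = "\<Sum>i\<in>UNIV. Z $ i" and ?M = "tilted_mean \<mu> \<theta>"
  have s: "?s > 0" by (rule sum_pos) (auto intro: assms)
  have "(\<Sum>j\<in>UNIV. \<bar>((1 / ?s) *\<^sub>R Z) $ j\<bar>) = (\<Sum>j\<in>UNIV. Z $ j / ?s)"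
    using s assms(3) by (intro sum.cong) (auto simp: abs_mult less_imp_le)
  also have "\<dots> = 1" using s by (simp flip: sum_divide_distrib)
  finally have norm: "(\<Sum>j\<in>UNIV. \<bar>((1 / ?s) *\<^sub>R Z) $ j\<bar>) = 1" .
  have eig: "((1 / ?s) *\<^sub>R Z) v* ?M = (1 / ?s) *\<^sub>R Z"
    by (simp add: scaleR_vector_matrix_assoc assms(4))
  show "(\<forall>j. ((1 / ?s) *\<^sub>R Z) $ j > 0) \<and> ((1 / ?s) *\<^sub>R Z) v* ?M = (1 / ?s) *\<^sub>R Z
      \<and> (\<Sum>j\<in>UNIV. \<bar>((1 / ?s) *\<^sub>R Z) $ j\<bar>) = 1"
    using norm eig s assms(3) by simp
  fix X assume X: "(\<forall>j. X $ j > 0) \<and> X v* ?M = X \<and> (\<Sum>j\<in>UNIV. \<bar>X $ j\<bar>) = 1"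
  obtain t where t: "X = t *\<^sub>R Z"
    using left_eigenvector_unique[OF mean_matrix_nonneg strongly_connected_tilted_mean[OF assms(1,2)],
        of X \<theta> 1 Z] X assms(3,4) by auto
  have "1 = (\<Sum>j\<in>UNIV. X $ j)" using X by (metis (no_types, lifting) abs_of_pos sum.cong)
  also have "\<dots> = t * ?s" by (simp add: t sum_distrib_left)
  finally show "X = (1 / ?s) *\<^sub>R Z" using s t by (simp add: field_simps)
qed

lemma M_crit_iff:
  assumes "entire_proj \<mu>" "irreducible_proj \<mu>"
  shows "\<theta> \<in> M_crit \<mu> \<longleftrightarrow> (\<exists>X. (\<forall>i. X $ i > 0) \<and> X v* tilted_mean \<mu> \<theta> = X)"
proof
  assume "\<theta> \<in> M_crit \<mu>"
  then have r1: "spectral_radius (tilted_mean \<mu> \<theta>) = 1" by (simp add: M_crit_def)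
  obtain X r where X: "\<And>i. X $ i > 0" "X v* tilted_mean \<mu> \<theta> = r *\<^sub>R X"
    using ex_pos_left_eigenvector[OF mean_matrix_nonneg strongly_connected_tilted_mean[OF assms]] by blast
  have "r = 1"
    using spectral_radius_eq_left_eigenvalue[OF mean_matrix_nonneg X] r1 by simp
  with X show "\<exists>X. (\<forall>i. X $ i > 0) \<and> X v* tilted_mean \<mu> \<theta> = X" by auto
next
  assume "\<exists>X. (\<forall>i. X $ i > 0) \<and> X v* tilted_mean \<mu> \<theta> = X"
  then obtain X where "\<And>i. X $ i > 0" "X v* tilted_mean \<mu> \<theta> = 1 *\<^sub>R X" by auto
  from spectral_radius_eq_left_eigenvalue[OF mean_matrix_nonneg this] show "\<theta> \<in> M_crit \<mu>"
    by (simp add: M_crit_def)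
qed

lemma asy_dir_props:
  assumes "entire_proj \<mu>" "irreducible_proj \<mu>" "\<theta> \<in> M_crit \<mu>"
  shows "asy_dir \<mu> \<theta> $ i > 0" "asy_dir \<mu> \<theta> v* tilted_mean \<mu> \<theta> = asy_dir \<mu> \<theta>"
proof -
  obtain X where X: "\<And>i. X $ i > 0" "X v* tilted_mean \<mu> \<theta> = X"
    using iffD1[OF M_crit_iff[OF assms(1,2)] assms(3)] by (elim exE conjE) blast
  note eq = asy_dir_eq[OF assms(1,2) X]
  have "(\<Sum>i\<in>UNIV. X $ i) > 0" by (rule sum_pos) (auto intro: X)
  then show "asy_dir \<mu> \<theta> $ i > 0" using X by (simp add: eq)
  show "asy_dir \<mu> \<theta> v* tilted_mean \<mu> \<theta> = asy_dir \<mu> \<theta>"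
    by (simp add: eq scaleR_vector_matrix_assoc X(2))
qed

text \<open>
  A positive fixed left eigenvector of $M_\theta$ is, up to normalization, the asymptotic direction of
  \<open>\<theta>\<close>, and its existence makes \<open>\<theta>\<close> critical. So the cone can be described without the spectral
  radius.
\<close>

lemma D_asy_iff:
  assumes "entire_proj \<mu>" "irreducible_proj \<mu>"
  shows "X \<in> D_asy \<mu> \<longleftrightarrow> (\<forall>i. X $ i > 0) \<and> (\<exists>\<theta>. X v* tilted_mean \<mu> \<theta> = X)"
proof
  assume "X \<in> D_asy \<mu>"
  then obtain c \<theta> where "X = c *\<^sub>R asy_dir \<mu> \<theta>" "c > 0" "\<theta> \<in> M_crit \<mu>" by (auto simp: D_asy_def)
  then show "(\<forall>i. X $ i > 0) \<and> (\<exists>\<theta>. X v* tilted_mean \<mu> \<theta> = X)"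
    using asy_dir_props[OF assms] by (auto simp: scaleR_vector_matrix_assoc)
next
  assume "(\<forall>i. X $ i > 0) \<and> (\<exists>\<theta>. X v* tilted_mean \<mu> \<theta> = X)"
  then obtain \<theta> where X: "\<And>i. X $ i > 0" "X v* tilted_mean \<mu> \<theta> = X" by blast
  have "(\<Sum>i\<in>UNIV. X $ i) > 0" by (rule sum_pos) (auto intro: X)
  moreover from this have "X = (\<Sum>i\<in>UNIV. X $ i) *\<^sub>R asy_dir \<mu> \<theta>"
    by (simp add: asy_dir_eq[OF assms X])
  moreover have "\<theta> \<in> M_crit \<mu>" using X M_crit_iff[OF assms] by blast
  ultimately show "X \<in> D_asy \<mu>" unfolding D_asy_def by blast
qed

lemma D_asy_strict_min_on_sphere:
  assumes "entire_proj \<mu>" "nonlocalized_proj \<mu>" "irreducible_proj \<mu>" "X \<in> D_asy \<mu>"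
  obtains \<theta> where "\<And>\<eta>. \<eta> \<in> sphere \<theta> 1 \<Longrightarrow> X \<bullet> chi_map \<mu> \<theta> < X \<bullet> chi_map \<mu> \<eta>"
proof -
  obtain \<theta> where X: "\<And>i. X $ i > 0" "X v* tilted_mean \<mu> \<theta> = X"
    using iffD1[OF D_asy_iff[OF assms(1,3)] assms(4)] by (elim exE conjE) blast
  have "X \<bullet> chi_map \<mu> \<theta> < X \<bullet> chi_map \<mu> \<eta>" if "\<eta> \<in> sphere \<theta> 1" for \<eta>
    using that by (intro fixed_left_eigenvector_strict_min[OF assms(1,2) X]) auto
  then show ?thesis by (rule that)
qed

lemma D_asy_linear_growth:
  assumes "entire_proj \<mu>" "nonlocalized_proj \<mu>" "irreducible_proj \<mu>" "X \<in> D_asy \<mu>"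
  obtains \<delta> C where "\<delta> > 0" "\<And>\<theta>. \<delta> * norm \<theta> - C \<le> X \<bullet> chi_map \<mu> \<theta>"
proof -
  have "X $ i \<ge> 0" for i using D_asy_iff[OF assms(1,3)] assms(4) by (simp add: less_imp_le)
  note convex = convex_inner_chi_map[OF assms(1) this]
  obtain \<theta> where "\<And>\<eta>. \<eta> \<in> sphere \<theta> 1 \<Longrightarrow> X \<bullet> chi_map \<mu> \<theta> < X \<bullet> chi_map \<mu> \<eta>"
    using D_asy_strict_min_on_sphere[OF assms] by blast
  from convex_linear_growth[OF convex this] show ?thesis using that by blast
qed

text \<open>
  A minimizer of $X \cdot \chi$ exists by coercivity, and the first-order condition there says that \<open>X\<close>
  is fixed by the tilted mean matrix.
\<close>

lemma linear_growth_imp_D_asy: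
  assumes "entire_proj \<mu>" "irreducible_proj \<mu>" "\<And>i. X $ i > 0"
    and "\<delta> > 0" "\<And>\<theta>. \<delta> * norm \<theta> - C \<le> X \<bullet> chi_map \<mu> \<theta>"
  shows "X \<in> D_asy \<mu>"
proof -
  have "continuous_on UNIV (\<lambda>\<theta>. X \<bullet> chi_map \<mu> \<theta>)"
    by (intro continuous_intros continuous_chi_map assms)
  then obtain \<theta> where "\<And>\<eta>. X \<bullet> chi_map \<mu> \<theta> \<le> X \<bullet> chi_map \<mu> \<eta>"
    using linear_growth_attains_min[OF _ assms(4,5)] by blast
  moreover have "X \<noteq> 0" using assms(3)[of undefined] by auto
  ultimately have "X v* tilted_mean \<mu> \<theta> = X"
    using assms(3) by (intro minimizer_imp_fixed_left_eigenvector(1)[OF assms(1,2)]) (auto simp: less_imp_le)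
  then show ?thesis using D_asy_iff[OF assms(1,2)] assms(3) by blast
qed

lemma convex_D_asy:
  assumes "entire_proj \<mu>" "nonlocalized_proj \<mu>" "irreducible_proj \<mu>"
  shows "convex (D_asy \<mu>)"
proof (rule convexI)
  fix X Y :: "real ^ 'a" and u v :: real
  assume XY: "X \<in> D_asy \<mu>" "Y \<in> D_asy \<mu>" and uv: "0 \<le> u" "0 \<le> v" "u + v = 1"
  obtain \<delta> C where X: "\<delta> > 0" "\<And>\<theta>. \<delta> * norm \<theta> - C \<le> X \<bullet> chi_map \<mu> \<theta>"
    using D_asy_linear_growth[OF assms XY(1)] by blast
  obtain \<epsilon> D where Y: "\<epsilon> > 0" "\<And>\<theta>. \<epsilon> * norm \<theta> - D \<le> Y \<bullet> chi_map \<mu> \<theta>"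
    using D_asy_linear_growth[OF assms XY(2)] by blast
  have pos: "u * a + v * b > 0" if "a > 0" "b > 0" for a b :: real
    using that uv by (cases "u = 0") (auto intro: add_pos_nonneg)
  show "u *\<^sub>R X + v *\<^sub>R Y \<in> D_asy \<mu>"
  proof (rule linear_growth_imp_D_asy[OF assms(1,3)])
    show "(u *\<^sub>R X + v *\<^sub>R Y) $ i > 0" for i
      using pos XY D_asy_iff[OF assms(1,3)] by simp
    show "u * \<delta> + v * \<epsilon> > 0" using pos X(1) Y(1) by blast
    fix \<theta>
    have "u * (\<delta> * norm \<theta> - C) + v * (\<epsilon> * norm \<theta> - D)
        \<le> u * (X \<bullet> chi_map \<mu> \<theta>) + v * (Y \<bullet> chi_map \<mu> \<theta>)"
      by (intro add_mono mult_left_mono X(2) Y(2) uv)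
    then show "(u * \<delta> + v * \<epsilon>) * norm \<theta> - (u * C + v * D) \<le> (u *\<^sub>R X + v *\<^sub>R Y) \<bullet> chi_map \<mu> \<theta>"
      by (simp add: inner_add_left algebra_simps)
  qed
qed

text \<open>
  The minimizer \<open>\<theta>\<close> for \<open>X\<close> need not minimize $Y \cdot \chi$ for a nearby \<open>Y\<close>, but the value at \<open>\<theta>\<close>
  stays below all values on the sphere around it, and that suffices for linear growth.
\<close>

lemma open_D_asy:
  assumes "entire_proj \<mu>" "nonlocalized_proj \<mu>" "irreducible_proj \<mu>"
  shows "open (D_asy \<mu>)"
proof (subst open_subopen, intro ballI)
  fix X assume X: "X \<in> D_asy \<mu>"
  obtain \<theta> where \<theta>: "\<And>\<eta>. \<eta> \<in> sphere \<theta> 1 \<Longrightarrow> X \<bullet> chi_map \<mu> \<theta> < X \<bullet> chi_map \<mu> \<eta>"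
    using D_asy_strict_min_on_sphere[OF assms X] by blast
  define g where "g \<eta> = chi_map \<mu> \<eta> - chi_map \<mu> \<theta>" for \<eta>
  have cont: "continuous_on (sphere \<theta> 1) g"
    unfolding g_def by (intro continuous_intros continuous_chi_map assms)
  obtain p where p: "p \<in> sphere \<theta> 1" "\<And>\<eta>. \<eta> \<in> sphere \<theta> 1 \<Longrightarrow> X \<bullet> g p \<le> X \<bullet> g \<eta>"
    using continuous_attains_inf[of "sphere \<theta> 1" "\<lambda>\<eta>. X \<bullet> g \<eta>"] continuous_on_inner[OF continuous_on_const cont]
    by auto
  have m: "X \<bullet> g p > 0" using \<theta>[OF p(1)] by (simp add: g_def inner_diff_right)
  obtain B where B: "B > 0" "\<And>\<eta>. \<eta> \<in> sphere \<theta> 1 \<Longrightarrow> norm (g \<eta>) \<le> B"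
    using compact_imp_bounded[OF compact_continuous_image[OF cont compact_sphere]]
    by (auto simp: bounded_pos)
  define T where "T = {Y :: real ^ 'a. \<forall>i. 0 < Y $ i} \<inter> ball X (X \<bullet> g p / B)"
  have "{Y :: real ^ 'a. \<forall>i. 0 < Y $ i} = (\<Inter>i. {Y. 0 < Y $ i})" by auto
  then have "open {Y :: real ^ 'a. \<forall>i. 0 < Y $ i}"
    by (auto intro!: open_INT open_Collect_less continuous_intros)
  then have "open T" unfolding T_def by blast
  moreover have "X \<in> T" using X m B(1) D_asy_iff[OF assms(1,3)] by (simp add: T_def)
  moreover have "T \<subseteq> D_asy \<mu>"
  proof
    fix Y assume Y: "Y \<in> T"
    then have pos: "\<And>i. Y $ i > 0" by (simp add: T_def)
    have "Y \<bullet> chi_map \<mu> \<theta> < Y \<bullet> chi_map \<mu> \<eta>" if \<eta>: "\<eta> \<in> sphere \<theta> 1" for \<eta>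
    proof -
      have "(X - Y) \<bullet> g \<eta> \<le> norm (X - Y) * norm (g \<eta>)" by (rule norm_cauchy_schwarz)
      also have "\<dots> \<le> norm (X - Y) * B" by (intro mult_left_mono B(2) \<eta>) simp
      also have "\<dots> < X \<bullet> g p" using Y B(1) by (simp add: T_def dist_norm field_simps)
      also have "\<dots> \<le> X \<bullet> g \<eta>" by (rule p(2)[OF \<eta>])
      finally show ?thesis by (simp add: g_def inner_diff_left inner_diff_right)
    qed
    moreover have "convex_on UNIV (\<lambda>\<theta>. Y \<bullet> chi_map \<mu> \<theta>)"
      using pos by (intro convex_inner_chi_map assms) (simp add: less_imp_le)
    ultimately obtain \<delta> C where "\<delta> > 0" "\<And>\<theta>. \<delta> * norm \<theta> - C \<le> Y \<bullet> chi_map \<mu> \<theta>"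
      using convex_linear_growth[of "\<lambda>\<theta>. Y \<bullet> chi_map \<mu> \<theta>" \<theta>] by blast
    with pos show "Y \<in> D_asy \<mu>" by (intro linear_growth_imp_D_asy[OF assms(1,3)])
  qed
  ultimately show "\<exists>T. open T \<and> X \<in> T \<and> T \<subseteq> D_asy \<mu>" by blast
qed

section \<open>Existence of a critical parameter\<close>

text \<open>
  Take a finite tree all of whose offspring vectors are possible ones; it exists since finiteness has
  positive probability. Going from the leaves to the root, $Y_i \ge Y \cdot k$ gives $Y \ge 0$ at the
  type of every vertex: at a leaf \<open>k\<close> is 0, and elsewhere the coordinates of \<open>Y\<close> that count are those of
  children.
\<close>

lemma finite_proj_no_negative_descent:
  assumes "finite_proj \<mu>" and Y: "\<And>i k. k \<in> set_pmf (\<mu> i) \<Longrightarrow> Y \<bullet> rvec k \<le> Y $ i"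
  shows "Y $ i \<ge> 0"
proof -
  let ?S = "offspring_space \<mu> i"
  interpret product_prob_space "\<lambda>u. measure_pmf (\<mu> (label_type i u))" UNIV
    by unfold_locales
  have supp: "AE \<omega> in ?S. \<forall>u. \<omega> u \<in> set_pmf (\<mu> (label_type i u))"
    unfolding offspring_space_def AE_all_countable
    by (intro allI AE_PiM_component measure_pmf.prob_space_axioms) (auto simp: AE_measure_pmf_iff)
  have fin: "\<not> (AE \<omega> in ?S. infinite (bgw_tree \<omega>))"
  proof
    assume "AE \<omega> in ?S. infinite (bgw_tree \<omega>)"
    then have "AE \<omega> in ?S. \<not> finite (bgw_tree \<omega>)" by simp
    then have "\<P>(\<omega> in ?S. finite (bgw_tree \<omega>)) = 0"
      by (subst (asm) AE_iff_measurable[OF sets_finite_bgw_tree]) (auto simp: measure_def)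
    moreover have "\<P>(\<omega> in ?S. finite (bgw_tree \<omega>)) > 0" using assms(1) by (simp add: finite_proj_def)
    ultimately show False by simp
  qed
  have "\<exists>\<omega>. (\<forall>u. \<omega> u \<in> set_pmf (\<mu> (label_type i u))) \<and> finite (bgw_tree \<omega>)"
  proof (rule ccontr)
    assume none: "\<not> ?thesis"
    have "AE \<omega> in ?S. infinite (bgw_tree \<omega>)" using supp by eventually_elim (use none in blast)
    with fin show False by blast
  qed
  then obtain \<omega> where \<omega>: "\<And>u. \<omega> u \<in> set_pmf (\<mu> (label_type i u))" "finite (bgw_tree \<omega>)" by blast
  define N where "N = Max (length ` bgw_tree \<omega>)"
  have N: "length u \<le> N" if "u \<in> bgw_tree \<omega>" for u
    unfolding N_def using \<omega>(2) that by (intro Max_ge) auto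
  have "Y $ label_type i u \<ge> 0" if "u \<in> bgw_tree \<omega>" for u
    using that
  proof (induction "N - length u" arbitrary: u rule: less_induct)
    case less
    have "0 \<le> Y $ j * real (\<omega> u $ j)" for j
    proof (cases "\<omega> u $ j = 0")
      case False
      then have child: "(j, 0) # u \<in> bgw_tree \<omega>" using less.prems by (intro bgw_tree.child) auto
      then have "N - length ((j, 0 :: nat) # u) < N - length u" using N[OF child] by simp
      from less.hyps[OF this child] show ?thesis by simp
    qed simp
    then have "0 \<le> Y \<bullet> rvec (\<omega> u)" unfolding inner_rvec by (intro sum_nonneg)
    with Y[OF \<omega>(1)[of u]] show ?case by simp
  qed
  from this[OF bgw_tree.root] show ?thesis by simp
qed

text \<open>
  The types at which \<open>Y\<close> attains its minimum \<open>m\<close> are closed under having a child: with $Y \ge 0$, a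
  possible child of type \<open>j\<close> has $Y_j \le Y \cdot k \le m$. So \<open>Y\<close> is constant by irreducibility, and an
  offspring vector with at least two children gives $2m \le m$.
\<close>

lemma no_descent_direction:
  assumes "finite_proj \<mu>" "nondegenerate_proj \<mu>" "irreducible_proj \<mu>"
    and Y: "\<And>i k. k \<in> set_pmf (\<mu> i) \<Longrightarrow> Y \<bullet> rvec k \<le> Y $ i"
  shows "Y = 0"
proof -
  have nonneg: "Y $ i \<ge> 0" for i by (rule finite_proj_no_negative_descent[OF assms(1) Y])
  note sc = strongly_connected_mean_matrix[OF assms(3)]
  define m where "m = Min (range (\<lambda>i. Y $ i))"
  have m_le: "m \<le> Y $ i" for i unfolding m_def by simp
  have "m \<in> range (\<lambda>i. Y $ i)" unfolding m_def by (intro Min_in) auto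
  then obtain i\<^sub>0 where i\<^sub>0: "i\<^sub>0 \<in> {i. Y $ i = m}" by auto
  have closed: "j \<in> {i. Y $ i = m}" if i: "i \<in> {i. Y $ i = m}" and ij: "mean_matrix \<mu> $ i $ j > 0" for i j
  proof -
    obtain k where k: "k \<in> set_pmf (\<mu> i)" "k $ j > 0" using mean_matrix_posD[OF ij] .
    have "Y $ j * 1 \<le> Y $ j * real (k $ j)" using k(2) nonneg by (intro mult_left_mono) auto
    also have "\<dots> \<le> Y \<bullet> rvec k"
      unfolding inner_rvec by (rule member_le_sum) (auto simp: nonneg)
    also have "\<dots> \<le> m" using Y[OF k(1)] i by simp
    finally show ?thesis using m_le[of j] by simp
  qed
  have "i \<in> {i. Y $ i = m}" for i by (rule strongly_connectedD[OF sc i\<^sub>0 closed])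
  then have const: "Y $ i = m" for i by simp
  obtain i where "measure_pmf.prob (\<mu> i) {z. (\<Sum>j\<in>UNIV. z $ j) \<ge> 2} > 0"
    using assms(2) by (auto simp: nondegenerate_proj_def)
  then have "set_pmf (\<mu> i) \<inter> {z. (\<Sum>j\<in>UNIV. z $ j) \<ge> 2} \<noteq> {}"
    by (metis less_irrefl measure_Int_set_pmf measure_empty inf_commute)
  then obtain k where k: "k \<in> set_pmf (\<mu> i)" "(\<Sum>j\<in>UNIV. k $ j) \<ge> 2" by auto
  have m0: "m \<ge> 0" using nonneg[of i] const by simp
  have "m * 2 \<le> m * real (\<Sum>j\<in>UNIV. k $ j)" using k(2) m0 by (intro mult_left_mono) linarith+
  also have "\<dots> = Y \<bullet> rvec k" by (simp add: inner_rvec const sum_distrib_left)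
  also have "\<dots> \<le> m" using Y[OF k(1)] const by simp
  finally have "m = 0" using m0 by simp
  then show ?thesis using const by (simp add: vec_eq_iff)
qed

text \<open>
  A single term of the series is a lower bound for the whole.
\<close>

lemma chi_map_ge_linear:
  assumes "entire_proj \<mu>" "k \<in> set_pmf (\<mu> i)"
  shows "ln (pmf (\<mu> i) k) + (\<theta> \<bullet> rvec k - \<theta> $ i) \<le> chi_map \<mu> \<theta> $ i"
proof -
  let ?f = "\<lambda>k. pmf (\<mu> i) k * exp (\<theta> \<bullet> rvec k)"
  have pos: "pmf (\<mu> i) k > 0" using assms(2) by (rule pmf_positive)
  have "?f k \<le> laplace (pmf (\<mu> i)) \<theta>"
    using has_sum_mono2[of ?f "{k}" "?f k" UNIV] has_sum_laplace[OF entire_weight_pmf[OF assms(1)]]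
    by (simp add: has_sum_finiteI)
  then have "ln (?f k) \<le> ln (laplace (pmf (\<mu> i)) \<theta>)"
    using pos by (subst ln_le_cancel_iff) (auto simp: laplace_pos[OF assms(1)])
  then show ?thesis using pos by (simp add: chi_map_nth ln_mult)
qed

text \<open>
  By \<open>no_descent_direction\<close> and compactness of the sphere, finitely many pairs of a type and an offspring
  vector suffice to find a positive slope in every direction. Each of these slopes is bounded by
  $\chi_i$ up to a constant, and so by $e^{\chi_i}$.
\<close>

lemma sum_exp_chi_map_linear_growth:
  assumes "entire_proj \<mu>" "finite_proj \<mu>" "nondegenerate_proj \<mu>" "irreducible_proj \<mu>"
  obtains \<delta> C where "\<delta> > 0" "\<And>\<theta>. \<delta> * norm \<theta> - C \<le> (\<Sum>i\<in>UNIV. exp (chi_map \<mu> \<theta> $ i))"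
proof -
  define H where "H \<theta> = (\<Sum>i\<in>UNIV. exp (chi_map \<mu> \<theta> $ i))" for \<theta>
  define slope where "slope q Y = Y \<bullet> rvec (snd q) - Y $ fst q" for q :: "'a \<times> (nat ^ 'a)" and Y
  define Q where "Q = (SIGMA i:UNIV. set_pmf (\<mu> i))"
  have cont_slope: "continuous_on UNIV (slope q)" for q
    unfolding slope_def by (intro continuous_intros)
  have "\<exists>q\<in>Q. slope q Y > 0" if "Y \<in> sphere 0 1" for Y
  proof (rule ccontr)
    assume "\<not> ?thesis"
    then have "Y = 0"
      by (intro no_descent_direction[OF assms(2-4)]) (force simp: slope_def Q_def)
    with that show False by simp
  qed
  then have "sphere 0 1 \<subseteq> (\<Union>q\<in>Q. {Y. slope q Y > 0})" by blast
  moreover have "open {Y. slope q Y > 0}" for q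
    by (intro open_Collect_less cont_slope continuous_on_const)
  ultimately obtain T where T: "T \<subseteq> Q" "finite T" "sphere 0 1 \<subseteq> (\<Union>q\<in>T. {Y. slope q Y > 0})"
    using compactE_image[OF compact_sphere, of Q "\<lambda>q. {Y. slope q Y > 0}"] by metis
  \<comment> \<open>Positively homogeneous and positive on the sphere, hence bounded below by a multiple of the norm.\<close>
  define g where "g Y = (\<Sum>q\<in>T. max 0 (slope q Y))" for Y
  have "continuous_on (sphere 0 1) g"
    unfolding g_def by (intro continuous_intros continuous_on_subset[OF cont_slope]) auto
  moreover have sphere_ne: "sphere (0 :: real ^ 'a) 1 \<noteq> {}" by simp
  ultimately obtain p where p: "p \<in> sphere 0 1" "\<And>Y. Y \<in> sphere 0 1 \<Longrightarrow> g p \<le> g Y"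
    using continuous_attains_inf[OF compact_sphere] by metis
  obtain q\<^sub>0 where q\<^sub>0: "q\<^sub>0 \<in> T" "slope q\<^sub>0 p > 0" using T(3) p(1) by auto
  have "g p > 0"
    unfolding g_def by (rule sum_pos2[OF T(2) q\<^sub>0(1)]) (use q\<^sub>0 in auto)
  have g_norm: "g p * norm \<theta> \<le> g \<theta>" for \<theta>
  proof (cases "\<theta> = 0")
    case False
    define Y where "Y = (1 / norm \<theta>) *\<^sub>R \<theta>"
    have "\<theta> = norm \<theta> *\<^sub>R Y" using False by (simp add: Y_def)
    moreover have "slope q (r *\<^sub>R Y) = r * slope q Y" for q r
      by (simp add: slope_def right_diff_distrib)
    ultimately have "slope q \<theta> = norm \<theta> * slope q Y" for q by metis
    then have "g \<theta> = norm \<theta> * g Y"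
      by (simp add: g_def sum_distrib_left max_mult_distrib_left)
    moreover have "g p \<le> g Y" using False by (intro p(2)) (simp add: Y_def)
    ultimately show ?thesis by (simp add: mult.commute[of "g p"] mult_left_mono)
  qed (simp add: g_def sum_nonneg)
  define C where "C = (\<Sum>q\<in>T. \<bar>ln (pmf (\<mu> (fst q)) (snd q))\<bar>)"
  have g_le: "g \<theta> \<le> card T * H \<theta> + C" for \<theta>
  proof -
    have "max 0 (slope q \<theta>) \<le> H \<theta> + \<bar>ln (pmf (\<mu> (fst q)) (snd q))\<bar>" if "q \<in> T" for q
    proof -
      have "snd q \<in> set_pmf (\<mu> (fst q))" using that T(1) by (auto simp: Q_def)
      from chi_map_ge_linear[OF assms(1) this, of \<theta>]
      have "slope q \<theta> \<le> chi_map \<mu> \<theta> $ fst q + \<bar>ln (pmf (\<mu> (fst q)) (snd q))\<bar>"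
        by (simp add: slope_def)
      moreover have "chi_map \<mu> \<theta> $ fst q \<le> exp (chi_map \<mu> \<theta> $ fst q)"
        using exp_ge_add_one_self[of "chi_map \<mu> \<theta> $ fst q"] by linarith
      moreover have "exp (chi_map \<mu> \<theta> $ fst q) \<le> H \<theta>"
        unfolding H_def by (rule member_le_sum) auto
      moreover have "0 < exp (chi_map \<mu> \<theta> $ fst q)" by simp
      ultimately show ?thesis by linarith
    qed
    then have "g \<theta> \<le> (\<Sum>q\<in>T. H \<theta> + \<bar>ln (pmf (\<mu> (fst q)) (snd q))\<bar>)"
      unfolding g_def by (rule sum_mono)
    then show ?thesis by (simp add: C_def sum.distrib)
  qed
  have card: "card T > 0" using T(2) q\<^sub>0(1) by (auto simp: card_gt_0_iff)
  show ?thesis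
  proof (rule that[of "g p / card T" "C / card T"])
    show "g p / card T > 0" using card \<open>g p > 0\<close> by simp
    fix \<theta>
    have "g p * norm \<theta> - C \<le> card T * H \<theta>" using g_norm[of \<theta>] g_le[of \<theta>] by linarith
    then show "g p / card T * norm \<theta> - C / card T \<le> (\<Sum>i\<in>UNIV. exp (chi_map \<mu> \<theta> $ i))"
      unfolding H_def[symmetric] using card by (simp add: field_simps)
  qed
qed

lemma D_asy_nonempty:
  assumes "entire_proj \<mu>" "finite_proj \<mu>" "nondegenerate_proj \<mu>" "irreducible_proj \<mu>"
  shows "D_asy \<mu> \<noteq> {}"
proof -
  let ?a = "\<lambda>\<theta>. \<chi> i. exp (chi_map \<mu> \<theta> $ i)"
  have cont: "continuous_on UNIV (\<lambda>\<theta>. exp (chi_map \<mu> \<theta> $ i))" for i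
    by (intro continuous_intros continuous_chi_map assms)
  obtain \<delta> C where "\<delta> > 0" "\<And>\<theta>. \<delta> * norm \<theta> - C \<le> (\<Sum>i\<in>UNIV. exp (chi_map \<mu> \<theta> $ i))"
    using sum_exp_chi_map_linear_growth[OF assms] by blast
  moreover have "continuous_on UNIV (\<lambda>\<theta>. \<Sum>i\<in>UNIV. exp (chi_map \<mu> \<theta> $ i))"
    by (intro continuous_intros cont)
  ultimately obtain \<theta> where
    min: "\<And>\<eta>. (\<Sum>i\<in>UNIV. exp (chi_map \<mu> \<theta> $ i)) \<le> (\<Sum>i\<in>UNIV. exp (chi_map \<mu> \<eta> $ i))"
    using linear_growth_attains_min by blast
  have "?a \<theta> v* tilted_mean \<mu> \<theta> = ?a \<theta>"
  proof (rule fixed_left_eigenvectorI[OF assms(1)])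
    show "continuous_on UNIV ?a" by (intro continuous_on_vec_lambda cont)
    show "0 \<le> ?a \<eta> $ i" for \<eta> i by simp
    fix \<eta>
    \<comment> \<open>The tangent of \<open>exp\<close> at \<open>y\<close> lies below its graph.\<close>
    have tangent: "exp y * x - exp y * y \<le> exp x - exp y" for x y :: real
    proof -
      have "exp y * (1 + (x - y)) \<le> exp y * exp (x - y)" by (intro mult_left_mono) auto
      then show ?thesis by (simp add: algebra_simps flip: exp_add)
    qed
    have "(\<Sum>i\<in>UNIV. exp (chi_map \<mu> \<eta> $ i) * chi_map \<mu> \<theta> $ i - exp (chi_map \<mu> \<eta> $ i) * chi_map \<mu> \<eta> $ i)
        \<le> (\<Sum>i\<in>UNIV. exp (chi_map \<mu> \<theta> $ i) - exp (chi_map \<mu> \<eta> $ i))"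
      by (intro sum_mono tangent)
    also have "\<dots> \<le> 0" using min[of \<eta>] by (simp add: sum_subtractf)
    finally show "?a \<eta> \<bullet> chi_map \<mu> \<theta> \<le> ?a \<eta> \<bullet> chi_map \<mu> \<eta>"
      by (simp add: inner_vec_def sum_subtractf)
  qed
  then have "?a \<theta> \<in> D_asy \<mu>" unfolding D_asy_iff[OF assms(1,4)] by auto
  then show ?thesis by blast
qed

section \<open>A convex program over the equivalence class\<close>

text \<open>
  The pair $(\theta_0, 0)$ is feasible with objective 0, so only feasible pairs with $X \cdot w \le 0$
  compete. They form a compact set: $X \cdot \chi(\theta) \le X \cdot \chi(\theta_0) + X \cdot w$ confines
  \<open>\<theta>\<close> by linear growth, the constraint then bounds \<open>w\<close> below, and $X \cdot w \le 0$ with $X > 0$ bounds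
  it above.
\<close>

lemma convex_program_optimum:
  fixes W :: "(real ^ 'k::finite) set"
  assumes "entire_proj \<mu>" "nonlocalized_proj \<mu>" "irreducible_proj \<mu>" "X \<in> D_asy \<mu>" "subspace W"
  obtains \<theta> w where "w \<in> W" "\<forall>i. chi_map \<mu> \<theta> $ i - chi_map \<mu> \<theta>\<^sub>0 $ i \<le> w $ i"
    and "\<forall>v\<in>W. \<forall>\<eta>. (\<forall>i. chi_map \<mu> \<eta> $ i - chi_map \<mu> \<theta>\<^sub>0 $ i \<le> v $ i) \<longrightarrow> X \<bullet> w \<le> X \<bullet> v"
proof -
  define c where "c = chi_map \<mu> \<theta>\<^sub>0"
  have X: "X $ i > 0" for i using D_asy_iff[OF assms(1,3)] assms(4) by simp
  define K where "K = {q. snd q \<in> W} \<inter> {q. \<forall>i. chi_map \<mu> (fst q) $ i - c $ i \<le> snd q $ i} \<inter> {q. X \<bullet> snd q \<le> 0}"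
  obtain \<delta> C where growth: "\<delta> > 0" "\<And>\<theta>. \<delta> * norm \<theta> - C \<le> X \<bullet> chi_map \<mu> \<theta>"
    using D_asy_linear_growth[OF assms(1-4)] by blast
  define R where "R = (C + X \<bullet> c) / \<delta>"
  have "continuous_on (cball 0 R) (\<lambda>\<theta>. chi_map \<mu> \<theta> - c)"
    by (intro continuous_intros continuous_chi_map assms)
  then have "bounded ((\<lambda>\<theta>. chi_map \<mu> \<theta> - c) ` cball 0 R)"
    by (intro compact_imp_bounded compact_continuous_image compact_cball)
  then obtain B where B: "B > 0" "\<And>\<theta>. \<theta> \<in> cball 0 R \<Longrightarrow> norm (chi_map \<mu> \<theta> - c) \<le> B"
    by (auto simp: bounded_pos)
  have sub: "K \<subseteq> cball 0 R \<times> cbox (\<chi> i. - B) (\<chi> i. B * (\<Sum>j\<in>UNIV. X $ j) / X $ i)"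
  proof
    fix q assume q: "q \<in> K"
    obtain \<theta> w where q_eq: "q = (\<theta>, w)" by (cases q)
    have le: "\<And>i. chi_map \<mu> \<theta> $ i - c $ i \<le> w $ i" and Xw: "X \<bullet> w \<le> 0"
      using q by (auto simp: K_def q_eq)
    have "X \<bullet> (chi_map \<mu> \<theta> - c) \<le> X \<bullet> w"
      unfolding inner_vec_def by (rule sum_mono) (use le X in \<open>simp add: less_imp_le\<close>)
    then have "\<delta> * norm \<theta> \<le> C + X \<bullet> c" using growth(2)[of \<theta>] Xw by (simp add: inner_diff_right)
    then have \<theta>: "\<theta> \<in> cball 0 R" using growth(1) by (simp add: R_def field_simps)
    have lower: "- B \<le> w $ i" for i
      using component_le_norm_cart[of "chi_map \<mu> \<theta> - c" i] B(2)[OF \<theta>] le[of i] by simp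
    have "w $ i \<le> B * (\<Sum>j\<in>UNIV. X $ j) / X $ i" for i
    proof -
      \<comment> \<open>All summands \<open>X $ j * (w $ j + B)\<close> are nonnegative, so one of them is at most the sum.\<close>
      have "X $ i * w $ i + X $ i * B \<le> (\<Sum>j\<in>UNIV. X $ j * w $ j + X $ j * B)"
      proof (rule member_le_sum)
        show "0 \<le> X $ j * w $ j + X $ j * B" for j
          using mult_left_mono[OF lower[of j], of "X $ j"] X[of j] by simp
      qed auto
      also have "\<dots> \<le> B * (\<Sum>j\<in>UNIV. X $ j)"
        using Xw by (simp add: inner_vec_def sum.distrib sum_distrib_left mult_ac)
      finally have "X $ i * w $ i \<le> B * (\<Sum>j\<in>UNIV. X $ j)"
        using mult_pos_pos[OF X[of i] B(1)] by linarith
      then show ?thesis using X[of i] by (simp add: field_simps)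
    qed
    with lower \<theta> show "q \<in> cball 0 R \<times> cbox (\<chi> i. - B) (\<chi> i. B * (\<Sum>j\<in>UNIV. X $ j) / X $ i)"
      by (simp add: q_eq mem_box_cart)
  qed
  have "continuous_on UNIV (\<lambda>q :: (real ^ 'k) \<times> (real ^ 'k). chi_map \<mu> (fst q))"
    by (rule continuous_on_compose2[OF continuous_chi_map[OF assms(1)]]) (auto intro: continuous_intros)
  then have "closed {q. \<forall>i. chi_map \<mu> (fst q) $ i - c $ i \<le> snd q $ i}"
    by (intro closed_Collect_all closed_Collect_le continuous_intros)
  moreover have "closed {q :: (real ^ 'k) \<times> (real ^ 'k). snd q \<in> W}"
    using closed_vimage_snd[OF closed_subspace[OF assms(5)]] by (simp add: vimage_def)
  moreover have "closed {q :: (real ^ 'k) \<times> (real ^ 'k). X \<bullet> snd q \<le> 0}"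
    by (intro closed_Collect_le continuous_intros)
  ultimately have "closed K" unfolding K_def by blast
  moreover have "bounded K"
    using sub by (rule bounded_subset[rotated]) (intro bounded_Times bounded_cball bounded_cbox)
  ultimately have compact: "compact K" by (simp add: compact_eq_bounded_closed)
  have "(\<theta>\<^sub>0, 0) \<in> K" using subspace_0[OF assms(5)] by (simp add: K_def c_def)
  moreover have "continuous_on K (\<lambda>q. X \<bullet> snd q)" by (intro continuous_intros)
  ultimately obtain q where q: "q \<in> K" "\<And>r. r \<in> K \<Longrightarrow> X \<bullet> snd q \<le> X \<bullet> snd r"
    using continuous_attains_inf[OF compact] by blast
  show ?thesis
  proof (rule that[of "snd q" "fst q"])
    show "snd q \<in> W" "\<forall>i. chi_map \<mu> (fst q) $ i - chi_map \<mu> \<theta>\<^sub>0 $ i \<le> snd q $ i"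
      using q(1) by (auto simp: K_def c_def)
    show "\<forall>v\<in>W. \<forall>\<eta>. (\<forall>i. chi_map \<mu> \<eta> $ i - chi_map \<mu> \<theta>\<^sub>0 $ i \<le> v $ i) \<longrightarrow> X \<bullet> snd q \<le> X \<bullet> v"
    proof (intro ballI allI impI)
      fix \<eta> v assume v: "v \<in> W" "\<forall>i. chi_map \<mu> \<eta> $ i - chi_map \<mu> \<theta>\<^sub>0 $ i \<le> v $ i"
      show "X \<bullet> snd q \<le> X \<bullet> v"
      proof (cases "X \<bullet> v \<le> 0")
        case True
        then have "(\<eta>, v) \<in> K" using v by (simp add: K_def c_def)
        from q(2)[OF this] show ?thesis by simp
      next
        case False
        then show ?thesis using q(1) by (simp add: K_def)
      qed
    qed
  qed
qed

lemma nonneg_if_add_mult_nonneg: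
  fixes a b :: real
  assumes "\<And>t. t > 0 \<Longrightarrow> 0 \<le> a + t * b"
  shows "0 \<le> a" "0 \<le> b"
proof -
  show "0 \<le> b"
  proof (rule ccontr)
    assume b: "\<not> 0 \<le> b"
    define t where "t = (\<bar>a\<bar> + 1) / - b"
    have "t > 0" unfolding t_def by (rule divide_pos_pos) (use b in auto)
    moreover have "t * b = - (\<bar>a\<bar> + 1)" using b by (simp add: t_def field_simps)
    ultimately show False using assms[of t] by simp
  qed
  show "0 \<le> a"
  proof (rule tendsto_lowerbound)
    show "((\<lambda>t. a + t * b) \<longlongrightarrow> a) (at_right 0)"
      by (auto intro!: tendsto_eq_intros)
    show "\<forall>\<^sub>F t in at_right 0. 0 \<le> a + t * b"
      by (rule eventually_mono[OF eventually_at_right_less]) (rule assms)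
  qed simp
qed

text \<open>
  Separate the origin from the convex set of all achievable pairs of an objective excess and a
  constraint violation. The separating hyperplane may be vertical, that is $\alpha = 0$, if no feasible
  point satisfies all constraints strictly.
\<close>

lemma ex_lagrange_multipliers:
  fixes W :: "(real ^ 'k::finite) set"
  assumes "entire_proj \<mu>" "subspace W"
    and opt: "\<forall>v\<in>W. \<forall>\<eta>. (\<forall>i. chi_map \<mu> \<eta> $ i - c $ i \<le> v $ i) \<longrightarrow> p \<le> X \<bullet> v"
    and c: "c = chi_map \<mu> \<theta>\<^sub>0"
  obtains \<alpha> Z where "\<alpha> \<ge> 0" "\<And>i. Z $ i \<ge> 0" "\<alpha> \<noteq> 0 \<or> Z \<noteq> 0"
    and "\<And>w. w \<in> W \<Longrightarrow> (\<alpha> *\<^sub>R X - Z) \<bullet> w = 0"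
    and "\<And>\<eta>. \<alpha> * p \<le> Z \<bullet> (chi_map \<mu> \<eta> - c)"
proof -
  \<comment> \<open>The strict inequality for the objective keeps the origin out of \<open>A\<close>.\<close>
  define A where "A = {(s, a). \<exists>\<eta>. \<exists>w\<in>W. X \<bullet> w - p < s \<and> (\<forall>i. chi_map \<mu> \<eta> $ i - c $ i - w $ i \<le> a $ i)}"
  have convex: "convex A"
  proof (rule convexI)
    fix q r :: "real \<times> (real ^ 'k)" and u v :: real
    assume "q \<in> A" "r \<in> A" and uv: "0 \<le> u" "0 \<le> v" "u + v = 1"
    then obtain s a \<eta> w s' a' \<eta>' w' where
      q: "q = (s, a)" "w \<in> W" "X \<bullet> w - p < s" "\<And>i. chi_map \<mu> \<eta> $ i - c $ i - w $ i \<le> a $ i" and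
      r: "r = (s', a')" "w' \<in> W" "X \<bullet> w' - p < s'" "\<And>i. chi_map \<mu> \<eta>' $ i - c $ i - w' $ i \<le> a' $ i"
      unfolding A_def by blast
    have v: "v = 1 - u" "u \<le> 1" using uv by auto
    have "u *\<^sub>R w + v *\<^sub>R w' \<in> W"
      by (intro subspace_add subspace_scale assms q r)
    moreover have "X \<bullet> (u *\<^sub>R w + v *\<^sub>R w') - p < u * s + v * s'"
    proof -
      have "X \<bullet> (u *\<^sub>R w + v *\<^sub>R w') - p = u * (X \<bullet> w - p) + v * (X \<bullet> w' - p)"
        by (simp add: v inner_add_right algebra_simps)
      also have "\<dots> < u * s + v * s'"
      proof (cases "u = 0")
        case False
        then have "u * (X \<bullet> w - p) < u * s" using uv q(3) by (intro mult_strict_left_mono) auto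
        moreover have "v * (X \<bullet> w' - p) \<le> v * s'" using uv r(3) by (intro mult_left_mono) auto
        ultimately show ?thesis by linarith
      qed (use uv r(3) in simp)
      finally show ?thesis .
    qed
    moreover have "chi_map \<mu> (u *\<^sub>R \<eta> + v *\<^sub>R \<eta>') $ i - c $ i - (u *\<^sub>R w + v *\<^sub>R w') $ i
        \<le> (u *\<^sub>R a + v *\<^sub>R a') $ i" for i
    proof -
      have "chi_map \<mu> (u *\<^sub>R \<eta> + v *\<^sub>R \<eta>') $ i \<le> u * chi_map \<mu> \<eta> $ i + v * chi_map \<mu> \<eta>' $ i"
        using convex_onD[OF convex_chi_map[OF assms(1)], of v \<eta> \<eta>' i] uv by (simp add: v)
      moreover have "u * (chi_map \<mu> \<eta> $ i - c $ i - w $ i) + v * (chi_map \<mu> \<eta>' $ i - c $ i - w' $ i)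
          \<le> u * a $ i + v * a' $ i"
        by (intro add_mono mult_left_mono q r uv)
      ultimately show ?thesis by (simp add: v algebra_simps)
    qed
    ultimately have "(u * s + v * s', u *\<^sub>R a + v *\<^sub>R a') \<in> A"
      unfolding A_def mem_Collect_eq case_prod_conv by blast
    then show "u *\<^sub>R q + v *\<^sub>R r \<in> A" by (simp add: q(1) r(1))
  qed
  have origin: "0 \<notin> A"
  proof
    assume "0 \<in> A"
    then obtain \<eta> w where "w \<in> W" "X \<bullet> w < p" "\<And>i. chi_map \<mu> \<eta> $ i - c $ i \<le> w $ i"
      by (auto simp: A_def zero_prod_def)
    with opt show False by force
  qed
  obtain z where z: "z \<noteq> 0" "\<And>x. x \<in> A \<Longrightarrow> 0 \<le> z \<bullet> x"
    using separating_hyperplane_set_0[OF convex origin] by auto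
  obtain \<alpha> Z where z_eq: "z = (\<alpha>, Z)" by (cases z)
  have sep: "0 \<le> \<alpha> * s + Z \<bullet> a"
    if "w \<in> W" "X \<bullet> w - p < s" "\<And>i. chi_map \<mu> \<eta> $ i - c $ i - w $ i \<le> a $ i" for s a \<eta> w
  proof -
    have "(s, a) \<in> A" using that by (auto simp: A_def)
    from z(2)[OF this] show ?thesis by (simp add: z_eq)
  qed
  have lagrangian: "0 \<le> \<alpha> * (X \<bullet> w - p) + Z \<bullet> (chi_map \<mu> \<eta> - c - w)" "0 \<le> \<alpha>" if "w \<in> W" for w \<eta>
  proof -
    have affine: "0 \<le> (\<alpha> * (X \<bullet> w - p) + Z \<bullet> (chi_map \<mu> \<eta> - c - w)) + t * \<alpha>" if "t > 0" for t
      using sep[OF \<open>w \<in> W\<close>, of "X \<bullet> w - p + t" \<eta> "chi_map \<mu> \<eta> - c - w"] that by (simp add: algebra_simps)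
    show "0 \<le> \<alpha> * (X \<bullet> w - p) + Z \<bullet> (chi_map \<mu> \<eta> - c - w)"
      by (rule nonneg_if_add_mult_nonneg(1)) (rule affine)
    show "0 \<le> \<alpha>"
      by (rule nonneg_if_add_mult_nonneg(2)) (rule affine)
  qed
  have W0: "0 \<in> W" by (rule subspace_0[OF assms(2)])
  show ?thesis
  proof (rule that[of \<alpha> Z])
    show "0 \<le> \<alpha>" by (rule lagrangian(2)[OF W0])
    show "\<alpha> \<noteq> 0 \<or> Z \<noteq> 0" using z(1) by (auto simp: z_eq zero_prod_def)
    show "0 \<le> Z $ i" for i
    proof -
      \<comment> \<open>At \<open>\<eta> = \<theta>\<^sub>0\<close>, \<open>w = 0\<close> every nonnegative violation is achievable with excess \<open>1 - p\<close>.\<close>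
      have "0 \<le> \<alpha> * (1 - p) + t * Z $ i" if "t > 0" for t
      proof -
        have "axis i t $ j \<ge> 0" for j using that by (simp add: axis_def)
        then show ?thesis
          using sep[OF W0, of "1 - p" \<theta>\<^sub>0 "axis i t"] by (simp add: c inner_axis mult.commute)
      qed
      then show ?thesis by (rule nonneg_if_add_mult_nonneg(2))
    qed
    show "\<alpha> * p \<le> Z \<bullet> (chi_map \<mu> \<eta> - c)" for \<eta>
      using lagrangian(1)[OF W0, of \<eta>] by simp
    have half: "0 \<le> (\<alpha> *\<^sub>R X - Z) \<bullet> w" if "w \<in> W" for w
    proof -
      have "0 \<le> - (\<alpha> * p) + t * ((\<alpha> *\<^sub>R X - Z) \<bullet> w)" if "t > 0" for t
        using lagrangian(1)[OF subspace_scale[OF assms(2) \<open>w \<in> W\<close>, of t], of \<theta>\<^sub>0]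
        by (simp add: c inner_diff_left algebra_simps)
      then show ?thesis by (rule nonneg_if_add_mult_nonneg(2))
    qed
    show "(\<alpha> *\<^sub>R X - Z) \<bullet> w = 0" if "w \<in> W" for w
      using half[OF that] half[OF subspace_neg[OF assms(2) that]] by simp
  qed
qed

text \<open>
  If $\Gamma X_\theta = 0$, then $X_\theta \cdot \chi$ is constant on the equivalence class of \<open>\<theta>\<close>, while
  \<open>\<theta>\<close> is its unique minimizer; so the class is a single point.
\<close>

lemma D_asy_proj_zero_imp:
  assumes "entire_proj \<mu>" "nonlocalized_proj \<mu>" "irreducible_proj \<mu>" "0 \<in> D_asy_proj \<mu> \<Gamma> \<theta>\<^sub>0"
  shows "\<theta>\<^sub>0 \<in> M_crit \<mu>" "real_matrix \<Gamma> *v asy_dir \<mu> \<theta>\<^sub>0 = 0"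
    "{\<theta>. proj_equiv \<mu> \<Gamma> \<theta> \<theta>\<^sub>0} = {\<theta>\<^sub>0}" "D_asy_proj \<mu> \<Gamma> \<theta>\<^sub>0 = {0}"
proof -
  obtain \<theta> where \<theta>: "\<theta> \<in> M_crit \<mu>" "proj_equiv \<mu> \<Gamma> \<theta> \<theta>\<^sub>0" "real_matrix \<Gamma> *v asy_dir \<mu> \<theta> = 0"
    using assms(4) by (auto simp: D_asy_proj_def)
  have level: "asy_dir \<mu> \<theta> \<bullet> chi_map \<mu> \<eta> = asy_dir \<mu> \<theta> \<bullet> chi_map \<mu> \<theta>\<^sub>0" if "proj_equiv \<mu> \<Gamma> \<eta> \<theta>\<^sub>0" for \<eta>
    using that \<theta>(3) by (auto simp: proj_equiv_def orthogonal_comp_def orthogonal_def inner_diff_right)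
  have unique: "\<eta> = \<theta>" if "proj_equiv \<mu> \<Gamma> \<eta> \<theta>\<^sub>0" for \<eta>
    using fixed_left_eigenvector_strict_min[OF assms(1,2) asy_dir_props[OF assms(1,3) \<theta>(1)], of \<eta>]
      level[OF that] level[OF \<theta>(2)] by force
  have refl: "proj_equiv \<mu> \<Gamma> \<theta>\<^sub>0 \<theta>\<^sub>0" by (simp add: proj_equiv_def subspace_0 subspace_orthogonal_comp)
  have \<theta>_eq: "\<theta> = \<theta>\<^sub>0" using unique[OF refl] by simp
  show "\<theta>\<^sub>0 \<in> M_crit \<mu>" "real_matrix \<Gamma> *v asy_dir \<mu> \<theta>\<^sub>0 = 0" using \<theta> by (auto simp: \<theta>_eq)
  show "{\<theta>. proj_equiv \<mu> \<Gamma> \<theta> \<theta>\<^sub>0} = {\<theta>\<^sub>0}" using unique refl by (auto simp: \<theta>_eq)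
  have "x = 0" if "x \<in> D_asy_proj \<mu> \<Gamma> \<theta>\<^sub>0" for x
    using that unique \<theta>(3) by (auto simp: D_asy_proj_def)
  with assms(4) show "D_asy_proj \<mu> \<Gamma> \<theta>\<^sub>0 = {0}" by blast
qed

text \<open>
  As $X_\theta - c X \in \ker \Gamma$, the functions $X_\theta \cdot \chi$ and $c X \cdot \chi$ differ by a
  constant on the class of \<open>\<theta>\<^sub>0\<close>; and \<open>\<theta>\<close> is the strict minimizer of the former.
\<close>

lemma inner_chi_map_less_on_proj_equiv:
  assumes "entire_proj \<mu>" "nonlocalized_proj \<mu>" "irreducible_proj \<mu>"
    and \<theta>: "\<theta> \<in> M_crit \<mu>" "proj_equiv \<mu> \<Gamma> \<theta> \<theta>\<^sub>0" "c > 0"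
      "real_matrix \<Gamma> *v asy_dir \<mu> \<theta> = c *\<^sub>R (real_matrix \<Gamma> *v X)"
    and \<eta>: "proj_equiv \<mu> \<Gamma> \<eta> \<theta>\<^sub>0" "\<eta> \<noteq> \<theta>"
  shows "X \<bullet> chi_map \<mu> \<theta> < X \<bullet> chi_map \<mu> \<eta>"
proof -
  have "real_matrix \<Gamma> *v (asy_dir \<mu> \<theta> - c *\<^sub>R X) = 0"
    using \<theta>(4) by (simp add: matrix_vector_mult_diff_distrib matrix_vector_mult_scaleR)
  then have "(asy_dir \<mu> \<theta> - c *\<^sub>R X) \<bullet> (chi_map \<mu> \<zeta> - chi_map \<mu> \<theta>\<^sub>0) = 0" if "proj_equiv \<mu> \<Gamma> \<zeta> \<theta>\<^sub>0" for \<zeta>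
    using that by (auto simp: proj_equiv_def orthogonal_comp_def orthogonal_def)
  from this[OF \<theta>(2)] this[OF \<eta>(1)]
  have "asy_dir \<mu> \<theta> \<bullet> chi_map \<mu> \<eta> - asy_dir \<mu> \<theta> \<bullet> chi_map \<mu> \<theta> = c * (X \<bullet> chi_map \<mu> \<eta> - X \<bullet> chi_map \<mu> \<theta>)"
    by (simp add: inner_diff_left inner_diff_right algebra_simps)
  moreover have "asy_dir \<mu> \<theta> \<bullet> chi_map \<mu> \<theta> < asy_dir \<mu> \<theta> \<bullet> chi_map \<mu> \<eta>"
    by (rule fixed_left_eigenvector_strict_min[OF assms(1,2) asy_dir_props[OF assms(1,3) \<theta>(1)] \<eta>(2)])
  ultimately have "0 < c * (X \<bullet> chi_map \<mu> \<eta> - X \<bullet> chi_map \<mu> \<theta>)" by linarith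
  with \<theta>(3) show ?thesis by (simp add: zero_less_mult_iff)
qed

text \<open>
  The multiplier \<open>Z\<close> of the convex program is proportional to the asymptotic direction of the optimal
  \<open>\<theta>\<close>. The exclusion of 0 from \<open>D_asy_proj \<mu> \<Gamma> \<theta>\<^sub>0\<close> takes the role of a constraint qualification: it
  rules out $\alpha = 0$.
\<close>

lemma ex_critical_with_projected_direction:
  fixes \<Gamma> :: "int ^ 'k::finite ^ 'l::finite"
  assumes "entire_proj \<mu>" "nonlocalized_proj \<mu>" "irreducible_proj \<mu>"
    and zero: "0 \<notin> D_asy_proj \<mu> \<Gamma> \<theta>\<^sub>0" and X: "X \<in> D_asy \<mu>" "real_matrix \<Gamma> *v X \<noteq> 0"
  obtains \<theta> c where "\<theta> \<in> M_crit \<mu>" "c > 0" "proj_equiv \<mu> \<Gamma> \<theta> \<theta>\<^sub>0"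
    "real_matrix \<Gamma> *v asy_dir \<mu> \<theta> = c *\<^sub>R (real_matrix \<Gamma> *v X)"
proof -
  define V where "V = {v. real_matrix \<Gamma> *v v = 0}"
  define W where "W = orthogonal_comp V"
  have "subspace V"
    unfolding V_def subspace_def by (auto simp: matrix_vector_right_distrib matrix_vector_mult_scaleR)
  then have VW: "orthogonal_comp W = V" unfolding W_def by (rule orthogonal_comp_self)
  have W: "subspace W" unfolding W_def by (rule subspace_orthogonal_comp)
  obtain \<theta> w where w: "w \<in> W" "\<forall>i. chi_map \<mu> \<theta> $ i - chi_map \<mu> \<theta>\<^sub>0 $ i \<le> w $ i"
    and opt: "\<forall>v\<in>W. \<forall>\<eta>. (\<forall>i. chi_map \<mu> \<eta> $ i - chi_map \<mu> \<theta>\<^sub>0 $ i \<le> v $ i) \<longrightarrow> X \<bullet> w \<le> X \<bullet> v"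
    by (rule convex_program_optimum[OF assms(1-3) X(1) W]) (rule that)
  obtain \<alpha> Z where \<alpha>: "\<alpha> \<ge> 0" and Z: "\<And>i. Z $ i \<ge> 0" and nz: "\<alpha> \<noteq> 0 \<or> Z \<noteq> 0"
    and orth: "\<And>w. w \<in> W \<Longrightarrow> (\<alpha> *\<^sub>R X - Z) \<bullet> w = 0"
    and min: "\<And>\<eta>. \<alpha> * (X \<bullet> w) \<le> Z \<bullet> (chi_map \<mu> \<eta> - chi_map \<mu> \<theta>\<^sub>0)"
    by (rule ex_lagrange_multipliers[OF assms(1) W opt refl]) (rule that; blast)
  have "\<alpha> *\<^sub>R X - Z \<in> V"
    unfolding VW[symmetric] using orth
    by (auto simp: orthogonal_comp_def orthogonal_def inner_commute)
  then have \<Gamma>Z: "real_matrix \<Gamma> *v Z = \<alpha> *\<^sub>R (real_matrix \<Gamma> *v X)"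
    by (simp add: V_def matrix_vector_mult_diff_distrib matrix_vector_mult_scaleR)
  have \<alpha>_pos: "\<alpha> > 0"
  proof (rule ccontr)
    assume "\<not> \<alpha> > 0"
    then have \<alpha>0: "\<alpha> = 0" using \<alpha> by simp
    have "Z \<bullet> chi_map \<mu> \<theta>\<^sub>0 \<le> Z \<bullet> chi_map \<mu> \<eta>" for \<eta>
      using min[of \<eta>] by (simp add: \<alpha>0 inner_diff_right)
    moreover have "Z \<noteq> 0" using nz \<alpha>0 by simp
    ultimately have eig: "Z v* tilted_mean \<mu> \<theta>\<^sub>0 = Z" "\<And>i. Z $ i > 0"
      using minimizer_imp_fixed_left_eigenvector[OF assms(1,3) Z] by auto
    have crit: "\<theta>\<^sub>0 \<in> M_crit \<mu>" using M_crit_iff[OF assms(1,3)] eig by blast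
    have "1 *\<^sub>R (real_matrix \<Gamma> *v asy_dir \<mu> \<theta>\<^sub>0) = 0"
      by (simp add: asy_dir_eq[OF assms(1,3) eig(2,1)] matrix_vector_mult_scaleR \<Gamma>Z \<alpha>0)
    moreover have "proj_equiv \<mu> \<Gamma> \<theta>\<^sub>0 \<theta>\<^sub>0"
      by (simp add: proj_equiv_def subspace_0 subspace_orthogonal_comp)
    ultimately show False
      using zero crit unfolding D_asy_proj_def mem_Collect_eq by (metis zero_less_one)
  qed
  have "Z \<noteq> 0" using \<Gamma>Z X(2) \<alpha>_pos by auto
  \<comment> \<open>Together with \<open>min\<close> and \<open>Zw\<close> this makes \<open>\<theta>\<close> a minimizer and forces equality.\<close>
  have slack: "Z \<bullet> (chi_map \<mu> \<theta> - chi_map \<mu> \<theta>\<^sub>0) \<le> Z \<bullet> w"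
    unfolding inner_vec_def by (rule sum_mono) (use w(2) Z in \<open>simp add: mult_left_mono\<close>)
  have Zw: "\<alpha> * (X \<bullet> w) = Z \<bullet> w" using orth[OF w(1)] by (simp add: inner_diff_left)
  have "Z \<bullet> chi_map \<mu> \<theta> \<le> Z \<bullet> chi_map \<mu> \<eta>" for \<eta>
    using min[of \<eta>] slack by (simp add: Zw inner_diff_right)
  from minimizer_imp_fixed_left_eigenvector[OF assms(1,3) Z \<open>Z \<noteq> 0\<close> this]
  have eig: "Z v* tilted_mean \<mu> \<theta> = Z" "\<And>i. Z $ i > 0" by auto
  \<comment> \<open>Complementary slackness: as all \<open>Z $ i\<close> are positive, no constraint can be slack.\<close>
  have "chi_map \<mu> \<theta> - chi_map \<mu> \<theta>\<^sub>0 = w"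
  proof (rule ccontr)
    assume "\<not> ?thesis"
    then obtain i where i: "chi_map \<mu> \<theta> $ i - chi_map \<mu> \<theta>\<^sub>0 $ i \<noteq> w $ i" by (auto simp: vec_eq_iff)
    have "Z \<bullet> (chi_map \<mu> \<theta> - chi_map \<mu> \<theta>\<^sub>0) < Z \<bullet> w"
      unfolding inner_vec_def
    proof (rule sum_strict_mono_ex1)
      show "\<forall>i\<in>UNIV. Z $ i \<bullet> (chi_map \<mu> \<theta> - chi_map \<mu> \<theta>\<^sub>0) $ i \<le> Z $ i \<bullet> w $ i"
        using w(2) Z by (simp add: mult_left_mono)
      show "\<exists>i\<in>UNIV. Z $ i \<bullet> (chi_map \<mu> \<theta> - chi_map \<mu> \<theta>\<^sub>0) $ i < Z $ i \<bullet> w $ i"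
        using spec[OF w(2), of i] i eig(2)[of i] by (intro bexI[of _ i]) auto
    qed simp
    with min[of \<theta>] Zw show False by simp
  qed
  with w(1) have equiv: "proj_equiv \<mu> \<Gamma> \<theta> \<theta>\<^sub>0" by (simp add: proj_equiv_def W_def V_def)
  have crit: "\<theta> \<in> M_crit \<mu>" using M_crit_iff[OF assms(1,3)] eig by blast
  have s: "(\<Sum>i\<in>UNIV. Z $ i) > 0" by (rule sum_pos) (auto intro: eig)
  show ?thesis
  proof (rule that[OF crit _ equiv])
    show "\<alpha> / (\<Sum>i\<in>UNIV. Z $ i) > 0" using s \<alpha>_pos by simp
    show "real_matrix \<Gamma> *v asy_dir \<mu> \<theta> = (\<alpha> / (\<Sum>i\<in>UNIV. Z $ i)) *\<^sub>R (real_matrix \<Gamma> *v X)"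
      by (simp add: asy_dir_eq[OF assms(1,3) eig(2,1)] matrix_vector_mult_scaleR \<Gamma>Z)
  qed
qed

section \<open>The theorem\<close>

theorem theorem3p7:
  fixes \<mu> :: "'k::finite projection"
  assumes "entire_proj \<mu>" and "finite_proj \<mu>" and "nondegenerate_proj \<mu>"
    and "nonlocalized_proj \<mu>" and "irreducible_proj \<mu>"
  shows "(D_asy \<mu> \<noteq> {} \<and> open (D_asy \<mu>) \<and> convex (D_asy \<mu>)) \<and>
    (\<forall>(\<Gamma> :: int ^ 'k ^ 'l::finite) \<theta>\<^sub>0. \<Gamma> \<noteq> 0 \<longrightarrow>
      (D_asy_proj \<mu> \<Gamma> \<theta>\<^sub>0 = {0} \<or> 0 \<notin> D_asy_proj \<mu> \<Gamma> \<theta>\<^sub>0) \<and>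
      (D_asy_proj \<mu> \<Gamma> \<theta>\<^sub>0 = {0} \<longrightarrow>
         \<theta>\<^sub>0 \<in> M_crit \<mu> \<and> real_matrix \<Gamma> *v asy_dir \<mu> \<theta>\<^sub>0 = 0 \<and>
         {\<theta>. proj_equiv \<mu> \<Gamma> \<theta> \<theta>\<^sub>0} = {\<theta>\<^sub>0}) \<and>
      (0 \<notin> D_asy_proj \<mu> \<Gamma> \<theta>\<^sub>0 \<longrightarrow>
         (\<forall>X \<in> D_asy \<mu>. real_matrix \<Gamma> *v X \<noteq> 0 \<longrightarrow>
            (\<exists>!p. case p of (\<theta>, c) \<Rightarrow>
               \<theta> \<in> M_crit \<mu> \<and> c > 0 \<and> proj_equiv \<mu> \<Gamma> \<theta> \<theta>\<^sub>0 \<and>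
               real_matrix \<Gamma> *v asy_dir \<mu> \<theta> = c *\<^sub>R (real_matrix \<Gamma> *v X)) \<and>
            (\<forall>\<theta> c.
               \<theta> \<in> M_crit \<mu> \<and> c > 0 \<and> proj_equiv \<mu> \<Gamma> \<theta> \<theta>\<^sub>0 \<and>
               real_matrix \<Gamma> *v asy_dir \<mu> \<theta> = c *\<^sub>R (real_matrix \<Gamma> *v X) \<longrightarrow>
               {\<theta>'. is_arg_max (\<lambda>\<eta>. - (X \<bullet> chi_map \<mu> \<eta>)) (\<lambda>\<eta>. proj_equiv \<mu> \<Gamma> \<eta> \<theta>\<^sub>0) \<theta>'} = {\<theta>}))))"
proof -
  note entire = assms(1) and nonloc = assms(4) and irred = assms(5)
  have shape: "D_asy \<mu> \<noteq> {} \<and> open (D_asy \<mu>) \<and> convex (D_asy \<mu>)"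
    using D_asy_nonempty open_D_asy convex_D_asy assms by blast
  have dichotomy: "D_asy_proj \<mu> \<Gamma> \<theta>\<^sub>0 = {0} \<or> 0 \<notin> D_asy_proj \<mu> \<Gamma> \<theta>\<^sub>0"
    for \<Gamma> :: "int ^ 'k ^ 'l" and \<theta>\<^sub>0
    using D_asy_proj_zero_imp(4)[OF entire nonloc irred] by blast
  have degenerate: "\<theta>\<^sub>0 \<in> M_crit \<mu> \<and> real_matrix \<Gamma> *v asy_dir \<mu> \<theta>\<^sub>0 = 0 \<and>
      {\<theta>. proj_equiv \<mu> \<Gamma> \<theta> \<theta>\<^sub>0} = {\<theta>\<^sub>0}"
    if "D_asy_proj \<mu> \<Gamma> \<theta>\<^sub>0 = {0}" for \<Gamma> :: "int ^ 'k ^ 'l" and \<theta>\<^sub>0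
  proof -
    have "0 \<in> D_asy_proj \<mu> \<Gamma> \<theta>\<^sub>0" using that by simp
    from D_asy_proj_zero_imp(1-3)[OF entire nonloc irred this] show ?thesis by (intro conjI)
  qed
  have maximizer: "{\<theta>'. is_arg_max (\<lambda>\<eta>. - (X \<bullet> chi_map \<mu> \<eta>)) (\<lambda>\<eta>. proj_equiv \<mu> \<Gamma> \<eta> \<theta>\<^sub>0) \<theta>'} = {\<theta>}"
    if "\<theta> \<in> M_crit \<mu>" "c > 0" "proj_equiv \<mu> \<Gamma> \<theta> \<theta>\<^sub>0"
      "real_matrix \<Gamma> *v asy_dir \<mu> \<theta> = c *\<^sub>R (real_matrix \<Gamma> *v X)"
    for \<Gamma> :: "int ^ 'k ^ 'l" and \<theta>\<^sub>0 \<theta> X c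
  proof -
    have less: "X \<bullet> chi_map \<mu> \<theta> < X \<bullet> chi_map \<mu> \<eta>" if "proj_equiv \<mu> \<Gamma> \<eta> \<theta>\<^sub>0" "\<eta> \<noteq> \<theta>" for \<eta>
      using inner_chi_map_less_on_proj_equiv[OF entire nonloc irred] that
        \<open>\<theta> \<in> M_crit \<mu>\<close> \<open>c > 0\<close> \<open>proj_equiv \<mu> \<Gamma> \<theta> \<theta>\<^sub>0\<close>
        \<open>real_matrix \<Gamma> *v asy_dir \<mu> \<theta> = c *\<^sub>R (real_matrix \<Gamma> *v X)\<close> by blast
    have "is_arg_max (\<lambda>\<eta>. - (X \<bullet> chi_map \<mu> \<eta>)) (\<lambda>\<eta>. proj_equiv \<mu> \<Gamma> \<eta> \<theta>\<^sub>0) \<theta>' \<longleftrightarrow> \<theta>' = \<theta>" for \<theta>'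
    proof
      assume "is_arg_max (\<lambda>\<eta>. - (X \<bullet> chi_map \<mu> \<eta>)) (\<lambda>\<eta>. proj_equiv \<mu> \<Gamma> \<eta> \<theta>\<^sub>0) \<theta>'"
      then show "\<theta>' = \<theta>" using less[of \<theta>'] that(3) by (auto simp: is_arg_max_def)
    next
      assume "\<theta>' = \<theta>"
      moreover have "\<not> X \<bullet> chi_map \<mu> \<eta> < X \<bullet> chi_map \<mu> \<theta>" if "proj_equiv \<mu> \<Gamma> \<eta> \<theta>\<^sub>0" for \<eta>
        using less[OF that] by (cases "\<eta> = \<theta>") auto
      ultimately show "is_arg_max (\<lambda>\<eta>. - (X \<bullet> chi_map \<mu> \<eta>)) (\<lambda>\<eta>. proj_equiv \<mu> \<Gamma> \<eta> \<theta>\<^sub>0) \<theta>'"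
        using that(3) by (auto simp: is_arg_max_def)
    qed
    then show ?thesis by blast
  qed
  have unique: "\<exists>!p. case p of (\<theta>, c) \<Rightarrow>
      \<theta> \<in> M_crit \<mu> \<and> c > 0 \<and> proj_equiv \<mu> \<Gamma> \<theta> \<theta>\<^sub>0 \<and>
      real_matrix \<Gamma> *v asy_dir \<mu> \<theta> = c *\<^sub>R (real_matrix \<Gamma> *v X)"
    if zero: "0 \<notin> D_asy_proj \<mu> \<Gamma> \<theta>\<^sub>0" and X: "X \<in> D_asy \<mu>" "real_matrix \<Gamma> *v X \<noteq> 0"
    for \<Gamma> :: "int ^ 'k ^ 'l" and \<theta>\<^sub>0 X
  proof -
    obtain \<theta> c where \<theta>: "\<theta> \<in> M_crit \<mu>" "c > 0" "proj_equiv \<mu> \<Gamma> \<theta> \<theta>\<^sub>0"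
      "real_matrix \<Gamma> *v asy_dir \<mu> \<theta> = c *\<^sub>R (real_matrix \<Gamma> *v X)"
      using ex_critical_with_projected_direction[OF entire nonloc irred zero X] by blast
    have others: "\<eta> = \<theta> \<and> d = c"
      if "\<eta> \<in> M_crit \<mu>" "d > 0" "proj_equiv \<mu> \<Gamma> \<eta> \<theta>\<^sub>0"
        "real_matrix \<Gamma> *v asy_dir \<mu> \<eta> = d *\<^sub>R (real_matrix \<Gamma> *v X)" for \<eta> d
    proof -
      have "\<eta> = \<theta>" using maximizer[OF that] maximizer[OF \<theta>] by simp
      have "d *\<^sub>R (real_matrix \<Gamma> *v X) = c *\<^sub>R (real_matrix \<Gamma> *v X)"
        unfolding that(4)[symmetric] \<theta>(4)[symmetric] \<open>\<eta> = \<theta>\<close> ..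
      then have "d = c" using X(2) by simp
      with \<open>\<eta> = \<theta>\<close> show ?thesis by simp
    qed
    show ?thesis
    proof (rule ex1I[of _ "(\<theta>, c)"], unfold case_prod_conv)
      show "\<theta> \<in> M_crit \<mu> \<and> c > 0 \<and> proj_equiv \<mu> \<Gamma> \<theta> \<theta>\<^sub>0 \<and>
        real_matrix \<Gamma> *v asy_dir \<mu> \<theta> = c *\<^sub>R (real_matrix \<Gamma> *v X)"
        by (intro conjI \<theta>)
    next
      fix q :: "(real ^ 'k) \<times> real"
      assume q: "case q of (\<theta>, c) \<Rightarrow> \<theta> \<in> M_crit \<mu> \<and> c > 0 \<and> proj_equiv \<mu> \<Gamma> \<theta> \<theta>\<^sub>0 \<and>
        real_matrix \<Gamma> *v asy_dir \<mu> \<theta> = c *\<^sub>R (real_matrix \<Gamma> *v X)"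
      obtain \<eta> d where q_eq: "q = (\<eta>, d)" by (cases q)
      show "q = (\<theta>, c)"
        using others[of \<eta> d] q unfolding q_eq case_prod_conv by blast
    qed
  qed
  show ?thesis
  proof (rule conjI[OF shape], intro allI impI conjI ballI)
    fix \<Gamma> :: "int ^ 'k ^ 'l" and \<theta>\<^sub>0 :: "real ^ 'k"
    show "D_asy_proj \<mu> \<Gamma> \<theta>\<^sub>0 = {0} \<or> 0 \<notin> D_asy_proj \<mu> \<Gamma> \<theta>\<^sub>0" by (rule dichotomy)
    show "\<theta>\<^sub>0 \<in> M_crit \<mu>" "real_matrix \<Gamma> *v asy_dir \<mu> \<theta>\<^sub>0 = 0"
      "{\<theta>. proj_equiv \<mu> \<Gamma> \<theta> \<theta>\<^sub>0} = {\<theta>\<^sub>0}" if "D_asy_proj \<mu> \<Gamma> \<theta>\<^sub>0 = {0}"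
      using degenerate[OF that] by blast+
  next
    fix \<Gamma> :: "int ^ 'k ^ 'l" and \<theta>\<^sub>0 X :: "real ^ 'k"
    assume "0 \<notin> D_asy_proj \<mu> \<Gamma> \<theta>\<^sub>0" "X \<in> D_asy \<mu>" "real_matrix \<Gamma> *v X \<noteq> 0"
    then show "\<exists>!p. case p of (\<theta>, c) \<Rightarrow>
        \<theta> \<in> M_crit \<mu> \<and> c > 0 \<and> proj_equiv \<mu> \<Gamma> \<theta> \<theta>\<^sub>0 \<and>
        real_matrix \<Gamma> *v asy_dir \<mu> \<theta> = c *\<^sub>R (real_matrix \<Gamma> *v X)"
      by (rule unique)
  qed (elim conjE, rule maximizer)
qed

end
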